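(* Let $n>2$. There is a constant $C_n>0$ depending only on $n$ such that the following holds. Let $u_0,u_1\in L^2(\mathbf{R}^n)\cap L^1(\mathbf{R}^n)$ and let $u$ be the solution of $$u_{tt}+Lu+Lu_t=0\ \text{ in }(0,\infty)\times\mathbf{R}^n,\qquad u(0,x)=u_0(x),\quad u_t(0,x)=u_1(x).$$ Then, for all sufficiently large $t$, $$\|u(t,\cdot)\|_{L^2}\le C_n\left(\|u_0\|_{L^2}+\|u_1\|_{L^2}+\|u_0\|_{L^1}+\|u_1\|_{L^1}\right)t^{-\frac{n-2}{4}}.$$
   Context: The Fourier transform is $\hat f(\xi)=\int_{\mathbf{R}^n}e^{-ix\cdot\xi}f(x)\,dx$. The operator $L=\log(I-\Delta)$ is the nonnegative self-adjoint operator on $L^2(\mathbf{R}^n)$ acting as the Fourier multiplier with symbol $\log(1+|\xi|^2)$, on its natural maximal domain; $L^{1/2}$ is the multiplier with symbol $\sqrt{\log(1+|\xi|^2)}$, with domain $D(L^{1/2})=\{f\in L^2(\mathbf{R}^n):\int_{\mathbf{R}^n}\log(1+|\xi|^2)|\hat f(\xi)|^2d\xi<\infty\}$. The solution is understood through the Fourier transform: for a.e. $\xi$, $\hat u(\cdot,\xi)$ solves the ODE $\hat u_{tt}+\log(1+|\xi|^2)\hat u+\log(1+|\xi|^2)\hat u_t=0$, $t>0$, with $\hat u(0,\xi)=\hat u_0(\xi)$, $\hat u_t(0,\xi)=\hat u_1(\xi)$. When $u_0\in D(L^{1/2})$ and $u_1\in L^2(\mathbf{R}^n)$, this is the unique mild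 solution $u\in C([0,\infty);D(L^{1/2}))\cap C^1([0,\infty);L^2(\mathbf{R}^n))$. *)

theory Defs
  imports "HOL-Analysis.Analysis"
begin

definition L1_space :: "('a::euclidean_space \<Rightarrow> complex) set" where
  "L1_space = {f. integrable lebesgue f}"

definition L1_norm :: "('a::euclidean_space \<Rightarrow> complex) \<Rightarrow> real" where
  "L1_norm f = (LINT x|lebesgue. norm (f x))"

definition L2_space :: "('a::euclidean_space \<Rightarrow> complex) set" where
  "L2_space = {f \<in> borel_measurable lebesgue. integrable lebesgue (\<lambda>x. (norm (f x))\<^sup>2)}"

definition L2_norm :: "('a::euclidean_space \<Rightarrow> complex) \<Rightarrow> real" where
  "L2_norm f = sqrt (LINT x|lebesgue. (norm (f x))\<^sup>2)"

definition fourier :: "('a::euclidean_space \<Rightarrow> complex) \<Rightarrow> 'a \<Rightarrow> complex" where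
  "fourier f \<xi> = (LINT x|lebesgue. exp (- \<i> * complex_of_real (x \<bullet> \<xi>)) * f x)"

text \<open>
  The Fourier--Plancherel transform of an \<open>L\<^sup>2\<close> function: \<open>g\<close> is the \<open>L\<^sup>2\<close> limit, as \<open>R\<close> tends to
  infinity, of the integrals over \<open>\<bar>x\<bar> \<le> R\<close>.  It is a relation because \<open>g\<close> is determined only
  up to null sets.  The convergence is stated with the nonnegative integral because the Bochner
  integral of a non-integrable function is 0.
\<close>

definition fourier_plancherel ::
    "('a::euclidean_space \<Rightarrow> complex) \<Rightarrow> ('a \<Rightarrow> complex) \<Rightarrow> bool" where
  "fourier_plancherel f g \<longleftrightarrow> f \<in> L2_space \<and> g \<in> L2_space \<and>
     ((\<lambda>R::real. \<integral>\<^sup>+ \<xi>. ennreal ((norm (fourier (\<lambda>x. indicator (cball 0 R) x * f x) \<xi> - g \<xi>))\<^sup>2)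
          \<partial>lebesgue) \<longlongrightarrow> 0) at_top"

text \<open>The symbol of \<open>L = log (I - \<Delta>)\<close>.\<close>

definition log_symbol :: "'a::euclidean_space \<Rightarrow> real" where
  "log_symbol \<xi> = ln (1 + (norm \<xi>)\<^sup>2)"

text \<open>
  The initial value problem \<open>y'' + a y + a y' = 0\<close> for \<open>t > 0\<close>, \<open>y(0) = c\<^sub>0\<close>, \<open>y'(0) = c\<^sub>1\<close>,
  where the derivative at 0 is one-sided.
\<close>

definition solves_mode :: "real \<Rightarrow> complex \<Rightarrow> complex \<Rightarrow> (real \<Rightarrow> complex) \<Rightarrow> bool" where
  "solves_mode a c\<^sub>0 c\<^sub>1 y \<longleftrightarrow>
     (\<exists>y' y''. (\<forall>t\<ge>0. (y has_vector_derivative y' t) (at t within {0..})) \<and>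
        (\<forall>t>0. (y' has_vector_derivative y'' t) (at t)) \<and>
        (\<forall>t>0. y'' t + a *\<^sub>R y t + a *\<^sub>R y' t = 0) \<and>
        y 0 = c\<^sub>0 \<and> y' 0 = c\<^sub>1)"

text \<open>
  Solutions of \<open>u\<^sub>t\<^sub>t + L u + L u\<^sub>t = 0\<close> with initial data \<open>u\<^sub>0\<close>, \<open>u\<^sub>1\<close> in \<open>L\<^sup>1 \<inter> L\<^sup>2\<close>, understood
  through the Fourier transform.  The function \<open>v\<close> chooses a representative of the transform of
  \<open>u(t)\<close> for every \<open>t\<close>; the exceptional null set of frequencies does not depend on \<open>t\<close>.
  Only the values \<open>u(t)\<close> with \<open>t \<ge> 0\<close> matter.
\<close>

definition log_damped_wave_solution ::
    "('a::euclidean_space \<Rightarrow> complex) \<Rightarrow> ('a \<Rightarrow> complex) \<Rightarrow> (real \<Rightarrow> 'a \<Rightarrow> complex) \<Rightarrow> bool" where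
  "log_damped_wave_solution u\<^sub>0 u\<^sub>1 u \<longleftrightarrow>
     (\<exists>v. (\<forall>t\<ge>0. fourier_plancherel (u t) (v t)) \<and>
        (AE \<xi> in lebesgue.
           solves_mode (log_symbol \<xi>) (fourier u\<^sub>0 \<xi>) (fourier u\<^sub>1 \<xi>) (\<lambda>t. v t \<xi>)))"

end

theory Submission
  imports Defs "HOL-Probability.Probability"
begin

text \<open>
  Every frequency mode is a damped oscillator. A Lyapunov function gives, uniformly in the symbol
  \<open>a = log (1 + |\<xi>|\<^sup>2)\<close>, the bound
  \<open>|v(t)|\<^sup>2 \<le> 4 exp (- min a 1 * t / 2) (|c\<^sub>0|\<^sup>2 + |c\<^sub>1|\<^sup>2 / a)\<close>. For \<open>|\<xi>| > 1\<close> this decays exponentially and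
  Plancherel controls the initial data; for \<open>|\<xi>| \<le> 1\<close> the transforms of the data are bounded by
  their \<open>L\<^sup>1\<close> norms, and the integral of \<open>exp (- t |\<xi>|\<^sup>2 / 4) / |\<xi>|\<^sup>2\<close>, finite for \<open>n > 2\<close>, is a multiple of
  \<open>t\<close> to the power \<open>- (n - 2) / 2\<close>.

  The two Plancherel inequalities, with non-sharp constants, come from one identity: integrating
  the squared modulus of the transform of \<open>f\<close> against a Gaussian turns it into a Gaussian average
  of \<open>|f x + f y|\<^sup>2\<close> minus a multiple of the squared norm of \<open>f\<close>.
\<close>

section \<open>Gaussian integrals\<close>

text \<open>The two Plancherel inequalities serve different functions: the upper one controls the
  data, the lower one controls \<open>u t\<close>, whose transform is only an L2 limit of transforms
  of cut-off functions. The constant in the theorem is free, so the factors 2 lost in squaring sums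
  are affordable; this permits working with squared norms in \<open>ennreal\<close>, where Fatou's
  lemma handles most of the limits. The Gaussian average is taken of the sum
  \<open>f x + f y\<close> and not of the difference because of the lower inequality: the sum tends
  to \<open>2 f x\<close>, and pointwise convergence alone then bounds the averages from below,
  while showing that averages of \<open>|f x - f y|^2\<close> tend to 0 would need a dominating
  function. The rate is dictated by \<open>u\<^sub>1\<close> at low frequencies:
  \<open>|c\<^sub>1|^2 / a\<close> behaves like \<open>|c\<^sub>1|^2 / |xi|^2\<close> near 0, and
  with \<open>c\<^sub>1\<close> merely bounded this is integrable exactly when \<open>n > 2\<close>.
  The contribution of \<open>u\<^sub>0\<close> is weakened to the same form.\<close>

lemma gaussian_fourier_real:
  fixes t :: real
  shows "integrable lborel (\<lambda>x. iexp (t * x) * complex_of_real (exp (- x\<^sup>2 / 2)))"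
    and "(LINT x|lborel. iexp (t * x) * complex_of_real (exp (- x\<^sup>2 / 2)))
           = complex_of_real (sqrt (2 * pi) * exp (- t\<^sup>2 / 2))"
proof -
  let ?h = "\<lambda>x. iexp (t * x) * complex_of_real (exp (- x\<^sup>2 / 2))"
  have eq: "?h x = complex_of_real (sqrt (2 * pi)) * (std_normal_density x *\<^sub>R iexp (t * x))" for x
    by (simp add: std_normal_density_def scaleR_conv_of_real)
  have int: "integrable lborel (\<lambda>x. std_normal_density x *\<^sub>R iexp (t * x))"
    by (rule Bochner_Integration.integrable_bound[of _ std_normal_density])
       (auto intro!: integrable_normal_density simp: normal_density_nonneg)
  show "integrable lborel ?h"
    unfolding eq by (rule integrable_mult_right) (rule int)
  have "(LINT x|lborel. std_normal_density x *\<^sub>R iexp (t * x)) = char std_normal_distribution t"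
    unfolding char_def by (subst integral_density) (auto simp: normal_density_nonneg)
  then show "integral\<^sup>L lborel ?h = complex_of_real (sqrt (2 * pi) * exp (- t\<^sup>2 / 2))"
    unfolding eq integral_mult_right_zero by (simp add: char_std_normal_distribution)
qed

text \<open>The integral of \<open>exp (- |x|^2 / 2)\<close>. Its square, \<open>(2 pi)^n\<close>,
  is the Plancherel constant for the unnormalised transform.\<close>

definition gauss_mass :: "'a::euclidean_space itself \<Rightarrow> real" where
  "gauss_mass _ = sqrt (2 * pi) ^ DIM('a)"

lemma gauss_mass_pos: "0 < gauss_mass TYPE('a::euclidean_space)"
  by (simp add: gauss_mass_def)

lemma norm_sq_eq_sum_Basis: "(norm x)\<^sup>2 = (\<Sum>b\<in>Basis. (x \<bullet> b)\<^sup>2)"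
  unfolding power2_norm_eq_inner by (subst euclidean_inner) (simp add: power2_eq_square)

text \<open>The integrand is a product over the coordinates and \<open>lborel\<close> is the image
  of a product measure, so the integral is the product of the one-dimensional ones, which are
  characteristic functions of the standard normal distribution up to scaling.\<close>

lemma gaussian_fourier:
  fixes w :: "'a::euclidean_space"
  shows "integrable lborel (\<lambda>x. iexp (w \<bullet> x) * complex_of_real (exp (- (norm x)\<^sup>2 / 2)))" (is "integrable _ ?h")
    and "(LINT x|lborel. iexp (w \<bullet> x) * complex_of_real (exp (- (norm x)\<^sup>2 / 2)))
           = complex_of_real (gauss_mass TYPE('a) * exp (- (norm w)\<^sup>2 / 2))"
proof -
  let ?g = "\<lambda>b x. iexp ((w \<bullet> b) * x) * complex_of_real (exp (- x\<^sup>2 / 2))"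
  let ?T = "\<lambda>f. \<Sum>b\<in>Basis. f b *\<^sub>R b :: 'a"
  interpret P: product_sigma_finite "\<lambda>b::'a. lborel :: real measure" ..
  have T[measurable]: "?T \<in> (\<Pi>\<^sub>M b\<in>Basis. lborel) \<rightarrow>\<^sub>M borel"
    by measurable
  have eq: "?h x = (\<Prod>b\<in>Basis. ?g b (x \<bullet> b))" for x
  proof -
    have "?h x = exp (\<Sum>b\<in>Basis. \<i> * complex_of_real ((w \<bullet> b) * (x \<bullet> b)) + complex_of_real (- (x \<bullet> b)\<^sup>2 / 2))"
      by (simp add: norm_sq_eq_sum_Basis sum.distrib sum_subtractf sum_distrib_left[symmetric] sum_divide_distrib[symmetric] sum_negf
          exp_of_real[symmetric] exp_add[symmetric] euclidean_inner[of w x])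
    also have "\<dots> = (\<Prod>b\<in>Basis. exp (\<i> * complex_of_real ((w \<bullet> b) * (x \<bullet> b)) + complex_of_real (- (x \<bullet> b)\<^sup>2 / 2)))"
      by (rule exp_sum) simp
    also have "\<dots> = (\<Prod>b\<in>Basis. ?g b (x \<bullet> b))"
      unfolding exp_add exp_of_real ..
    finally show ?thesis .
  qed
  have hT: "?h (?T f) = (\<Prod>b\<in>Basis. ?g b (f b))" for f
    unfolding eq by (intro prod.cong) (auto simp: inner_sum_left inner_Basis if_distrib cong: if_cong)
  have int: "integrable (\<Pi>\<^sub>M b\<in>Basis. lborel) (\<lambda>f. \<Prod>b\<in>(Basis::'a set). ?g b (f b))"
    by (intro P.product_integrable_prod gaussian_fourier_real) auto
  have meas: "?h \<in> borel_measurable borel"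
    by measurable
  show "integrable lborel ?h"
    unfolding lborel_eq[where 'a='a] by (subst integrable_distr_eq[OF T meas]) (simp only: hT int)
  have "integral\<^sup>L lborel ?h = (LINT f|Pi\<^sub>M Basis (\<lambda>_. lborel). (\<Prod>b\<in>(Basis::'a set). ?g b (f b)))"
    unfolding lborel_eq[where 'a='a] by (subst integral_distr[OF T meas]) (simp only: hT)
  also have "\<dots> = (\<Prod>b\<in>(Basis::'a set). LINT x|lborel. ?g b x)"
    by (intro P.product_integral_prod gaussian_fourier_real) auto
  also have "\<dots> = (\<Prod>b\<in>(Basis::'a set). complex_of_real (sqrt (2 * pi) * exp (- (w \<bullet> b)\<^sup>2 / 2)))"
    by (simp only: gaussian_fourier_real)
  also have "\<dots> = complex_of_real (gauss_mass TYPE('a) * exp (\<Sum>b\<in>(Basis::'a set). - (w \<bullet> b)\<^sup>2 / 2))"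
    by (simp add: prod.distrib gauss_mass_def exp_sum)
  also have "(\<Sum>b\<in>(Basis::'a set). - (w \<bullet> b)\<^sup>2 / 2) = - (norm w)\<^sup>2 / 2"
    by (simp add: norm_sq_eq_sum_Basis sum_negf sum_divide_distrib[symmetric])
  finally show "integral\<^sup>L lborel ?h = complex_of_real (gauss_mass TYPE('a) * exp (- (norm w)\<^sup>2 / 2))" .
qed

lemma nn_integral_lborel_affine:
  fixes g :: "'a::euclidean_space \<Rightarrow> ennreal"
  assumes [measurable]: "g \<in> borel_measurable borel" and "c \<noteq> 0"
  shows "(\<integral>\<^sup>+x. g x \<partial>lborel) = ennreal (\<bar>c\<bar> ^ DIM('a)) * (\<integral>\<^sup>+x. g (t + c *\<^sub>R x) \<partial>lborel)"
  by (subst lborel_affine[OF \<open>c \<noteq> 0\<close>, of t])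
     (simp add: nn_integral_density nn_integral_distr nn_integral_cmult)

lemma
  fixes g :: "'a::euclidean_space \<Rightarrow> 'b::{banach, second_countable_topology}"
  assumes g: "integrable lborel (\<lambda>x. g (t + c *\<^sub>R x))" and [measurable]: "g \<in> borel_measurable borel" and "c \<noteq> 0"
  shows integrable_lborel_affine: "integrable lborel g"
    and integral_lborel_affine:
      "integral\<^sup>L lborel g = \<bar>c\<bar> ^ DIM('a) *\<^sub>R (LINT x|lborel. g (t + c *\<^sub>R x))"
proof -
  have "integrable (density (distr lborel borel (\<lambda>x. t + c *\<^sub>R x)) (\<lambda>_. \<bar>c\<bar> ^ DIM('a))) g"
    using g by (simp add: integrable_density integrable_distr_eq)
  then show "integrable lborel g"
    using lborel_affine[OF \<open>c \<noteq> 0\<close>, of t] by simp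
  show "integral\<^sup>L lborel g = \<bar>c\<bar> ^ DIM('a) *\<^sub>R (LINT x|lborel. g (t + c *\<^sub>R x))"
    by (subst lborel_affine[OF \<open>c \<noteq> 0\<close>, of t]) (simp add: integral_density integral_distr)
qed

lemma gaussian_fourier_scaled:
  fixes w :: "'a::euclidean_space"
  assumes "0 < s"
  shows "integrable lborel (\<lambda>x. iexp (w \<bullet> x) * complex_of_real (exp (- (s * norm x)\<^sup>2 / 2)))" (is "integrable _ ?h")
    and "(LINT x|lborel. iexp (w \<bullet> x) * complex_of_real (exp (- (s * norm x)\<^sup>2 / 2)))
           = complex_of_real (gauss_mass TYPE('a) / s ^ DIM('a) * exp (- (norm w / s)\<^sup>2 / 2))"
proof -
  have eq: "?h (0 + (1/s) *\<^sub>R x) = iexp (((1/s) *\<^sub>R w) \<bullet> x) * complex_of_real (exp (- (norm x)\<^sup>2 / 2))" for x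
    using assms by simp
  have meas: "?h \<in> borel_measurable borel" by measurable
  have int: "integrable lborel (\<lambda>x. ?h (0 + (1/s) *\<^sub>R x))"
    unfolding eq by (rule gaussian_fourier)
  show "integrable lborel ?h"
    using integrable_lborel_affine[OF int meas] assms by simp
  have "integral\<^sup>L lborel ?h = \<bar>1/s\<bar> ^ DIM('a) *\<^sub>R (LINT x|lborel. ?h (0 + (1/s) *\<^sub>R x))"
    using integral_lborel_affine[OF int meas] assms by simp
  also have "(LINT x|lborel. ?h (0 + (1/s) *\<^sub>R x))
      = complex_of_real (gauss_mass TYPE('a) * exp (- (norm ((1/s) *\<^sub>R w))\<^sup>2 / 2))"
    unfolding eq by (rule gaussian_fourier)
  also have "norm ((1/s) *\<^sub>R w) = norm w / s"
    using assms by simp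
  finally show "integral\<^sup>L lborel ?h
      = complex_of_real (gauss_mass TYPE('a) / s ^ DIM('a) * exp (- (norm w / s)\<^sup>2 / 2))"
    using assms by (simp add: scaleR_conv_of_real power_one_over field_simps)
qed

lemma
  assumes "0 < s"
  shows integrable_gaussian: "integrable lborel (\<lambda>x::'a::euclidean_space. exp (- (s * norm x)\<^sup>2 / 2))"
    and integral_gaussian:
      "(LINT x|lborel. exp (- (s * norm (x::'a))\<^sup>2 / 2)) = gauss_mass TYPE('a) / s ^ DIM('a)"
proof -
  have "integrable lborel (\<lambda>x::'a. complex_of_real (exp (- (s * norm x)\<^sup>2 / 2)))"
    using gaussian_fourier_scaled(1)[OF assms, of "0::'a"] by simp
  then show "integrable lborel (\<lambda>x::'a. exp (- (s * norm x)\<^sup>2 / 2))"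
    by (simp only: complex_of_real_integrable_eq)
  have "complex_of_real (LINT x|lborel. exp (- (s * norm (x::'a))\<^sup>2 / 2))
      = (LINT x|lborel. complex_of_real (exp (- (s * norm (x::'a))\<^sup>2 / 2)))"
    by simp
  also have "\<dots> = complex_of_real (gauss_mass TYPE('a) / s ^ DIM('a))"
    using gaussian_fourier_scaled(2)[OF assms, of "0::'a"] by simp
  finally show "(LINT x|lborel. exp (- (s * norm (x::'a))\<^sup>2 / 2)) = gauss_mass TYPE('a) / s ^ DIM('a)"
    by (simp only: of_real_eq_iff)
qed

section \<open>Plancherel inequalities\<close>

text \<open>Passes from \<open>lebesgue\<close> to \<open>lborel\<close>: the product of
  \<open>lborel\<close> with itself is again \<open>lborel\<close> on the product type, so Fubini
  applies without a detour through completions.\<close>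

lemma fourier_borel:
  assumes "f \<in> borel_measurable borel"
  shows "fourier f \<xi> = (LINT x|lborel. iexp (- (x \<bullet> \<xi>)) * f x)"
  unfolding fourier_def using assms by (subst integral_completion) auto

lemma borel_measurable_fourier [measurable]:
  fixes f :: "'a::euclidean_space \<Rightarrow> complex"
  assumes [measurable]: "f \<in> borel_measurable borel"
  shows "fourier f \<in> borel_measurable borel"
  unfolding fourier_borel[OF assms] by measurable

lemma
  fixes g :: "'a::euclidean_space \<Rightarrow> complex" and k :: "'b::euclidean_space \<Rightarrow> complex"
  assumes g: "integrable lborel g" and k: "integrable lborel k"
  shows integrable_lborel_pair_mult: "integrable lborel (\<lambda>p. g (fst p) * k (snd p))"
    and integral_lborel_pair_mult:
      "(LINT p|lborel. g (fst p) * k (snd p)) = integral\<^sup>L lborel g * integral\<^sup>L lborel k"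
proof -
  have [measurable]: "g \<in> borel_measurable borel" "k \<in> borel_measurable borel"
    using g k by auto
  have int: "integrable (lborel \<Otimes>\<^sub>M lborel) (\<lambda>p. g (fst p) * k (snd p))"
    using g k by (intro lborel_pair.Fubini_integrable) (auto simp: norm_mult)
  then show "integrable lborel (\<lambda>p. g (fst p) * k (snd p))"
    by (simp add: lborel_prod)
  show "(LINT p|lborel. g (fst p) * k (snd p)) = integral\<^sup>L lborel g * integral\<^sup>L lborel k"
    using lborel_pair.integral_fst'[OF int] by (simp add: lborel_prod)
qed

lemma nn_integral_gaussian:
  "(\<integral>\<^sup>+x. ennreal (exp (- ((norm (x::'a::euclidean_space))\<^sup>2 / 2))) \<partial>lborel) = ennreal (gauss_mass TYPE('a))"
  using integrable_gaussian[of 1, where 'a='a] integral_gaussian[of 1, where 'a='a]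
  by (subst nn_integral_eq_integral) auto

text \<open>The transform of the regularising weight \<open>exp (- (s |xi|)^2 / 2)\<close>. It has
  width \<open>s\<close> and total mass \<open>(gauss_mass)^2\<close> for every \<open>s\<close>,
  hence acts as a multiple of an approximate identity when \<open>s\<close> tends to 0.\<close>

definition gauss_kernel :: "real \<Rightarrow> 'a::euclidean_space \<Rightarrow> real" where
  "gauss_kernel s w = gauss_mass TYPE('a) / s ^ DIM('a) * exp (- (norm w / s)\<^sup>2 / 2)"

lemma borel_measurable_gauss_kernel [measurable]: "gauss_kernel s \<in> borel_measurable borel"
  unfolding gauss_kernel_def[abs_def] by measurable

lemma gauss_kernel_nonneg: "0 < s \<Longrightarrow> 0 \<le> gauss_kernel s (w::'a::euclidean_space)"
  using gauss_mass_pos[where 'a='a] by (simp add: gauss_kernel_def less_imp_le)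

text \<open>The substitution \<open>y = x + s z\<close> moves \<open>s\<close> from the kernel into
  the argument of \<open>\<Phi>\<close>. The Gaussian weight in \<open>z\<close> is then fixed, and
  the limit in \<open>s\<close> becomes a pointwise one.\<close>

lemma nn_integral_gauss_kernel:
  fixes \<Phi> :: "'a::euclidean_space \<times> 'a \<Rightarrow> ennreal"
  assumes [measurable]: "\<Phi> \<in> borel_measurable borel" and s: "0 < s"
  shows "(\<integral>\<^sup>+p. \<Phi> p * ennreal (gauss_kernel s (snd p - fst p)) \<partial>lborel) =
    ennreal (gauss_mass TYPE('a)) *
      (\<integral>\<^sup>+x. \<integral>\<^sup>+z. \<Phi> (x, x + s *\<^sub>R z) * ennreal (exp (- (norm z)\<^sup>2 / 2)) \<partial>lborel \<partial>lborel)"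
proof -
  have [measurable]: "\<Phi> \<in> borel_measurable (borel \<Otimes>\<^sub>M borel)"
    using assms by (simp add: borel_prod)
  have "(\<integral>\<^sup>+p. \<Phi> p * ennreal (gauss_kernel s (snd p - fst p)) \<partial>lborel)
      = (\<integral>\<^sup>+x. \<integral>\<^sup>+y. \<Phi> (x, y) * ennreal (gauss_kernel s (y - x)) \<partial>lborel \<partial>lborel)"
    by (subst lborel_prod[symmetric], subst lborel.nn_integral_fst[symmetric]) auto
  also have "\<dots> = (\<integral>\<^sup>+x. ennreal (\<bar>s\<bar> ^ DIM('a)) *
      (\<integral>\<^sup>+z. \<Phi> (x, x + s *\<^sub>R z) * ennreal (gauss_kernel s ((x + s *\<^sub>R z) - x)) \<partial>lborel) \<partial>lborel)"
    using s by (intro nn_integral_cong nn_integral_lborel_affine) auto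
  also have "\<dots> = (\<integral>\<^sup>+x. \<integral>\<^sup>+z. ennreal (gauss_mass TYPE('a)) *
       (\<Phi> (x, x + s *\<^sub>R z) * ennreal (exp (- (norm z)\<^sup>2 / 2))) \<partial>lborel \<partial>lborel)"
  proof (intro nn_integral_cong, subst nn_integral_cmult[symmetric])
    fix x :: 'a
    show "(\<integral>\<^sup>+z. ennreal (\<bar>s\<bar> ^ DIM('a)) * (\<Phi> (x, x + s *\<^sub>R z) * ennreal (gauss_kernel s ((x + s *\<^sub>R z) - x))) \<partial>lborel)
      = (\<integral>\<^sup>+z. ennreal (gauss_mass TYPE('a)) * (\<Phi> (x, x + s *\<^sub>R z) * ennreal (exp (- (norm z)\<^sup>2 / 2))) \<partial>lborel)"
    proof (intro nn_integral_cong)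
      fix z :: 'a
      have "ennreal (\<bar>s\<bar> ^ DIM('a)) * ennreal (gauss_kernel s (s *\<^sub>R z))
          = ennreal (gauss_mass TYPE('a)) * ennreal (exp (- (norm z)\<^sup>2 / 2))"
        using s gauss_mass_pos[where 'a='a] by (simp add: ennreal_mult'[symmetric] gauss_kernel_def)
      then show "ennreal (\<bar>s\<bar> ^ DIM('a)) * (\<Phi> (x, x + s *\<^sub>R z) * ennreal (gauss_kernel s ((x + s *\<^sub>R z) - x)))
        = ennreal (gauss_mass TYPE('a)) * (\<Phi> (x, x + s *\<^sub>R z) * ennreal (exp (- (norm z)\<^sup>2 / 2)))"
        by (simp add: mult_ac) (simp add: mult.assoc[symmetric] mult.commute)
    qed
  qed auto
  also have "\<dots> = ennreal (gauss_mass TYPE('a)) *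
      (\<integral>\<^sup>+x. \<integral>\<^sup>+z. \<Phi> (x, x + s *\<^sub>R z) * ennreal (exp (- (norm z)\<^sup>2 / 2)) \<partial>lborel \<partial>lborel)"
    by (simp add: nn_integral_cmult)
  finally show ?thesis .
qed

text \<open>The kernel has the same mass in either variable. For \<open>snd\<close>, the order of
  integration is exchanged so that at fixed \<open>z\<close> the shift by \<open>s z\<close> is
  absorbed by translation invariance.\<close>

lemma
  fixes h :: "'a::euclidean_space \<Rightarrow> ennreal"
  assumes [measurable]: "h \<in> borel_measurable borel" and s: "0 < s"
  shows nn_integral_gauss_kernel_fst:
      "(\<integral>\<^sup>+p. h (fst p) * ennreal (gauss_kernel s (snd p - fst p :: 'a)) \<partial>lborel)
        = ennreal ((gauss_mass TYPE('a))\<^sup>2) * (\<integral>\<^sup>+x. h x \<partial>lborel)" (is ?fst)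
    and nn_integral_gauss_kernel_snd:
      "(\<integral>\<^sup>+p. h (snd p) * ennreal (gauss_kernel s (snd p - fst p :: 'a)) \<partial>lborel)
        = ennreal ((gauss_mass TYPE('a))\<^sup>2) * (\<integral>\<^sup>+x. h x \<partial>lborel)" (is ?snd)
proof -
  let ?Z = "gauss_mass TYPE('a)" and ?g = "\<lambda>z::'a. ennreal (exp (- (norm z)\<^sup>2 / 2))"
  have Z2: "ennreal ?Z * ennreal ?Z = ennreal (?Z\<^sup>2)"
    using gauss_mass_pos[where 'a='a] by (simp add: ennreal_mult'[symmetric] power2_eq_square)
  show ?fst
    by (subst nn_integral_gauss_kernel[OF _ s])
       (simp_all add: borel_prod[symmetric] nn_integral_cmult nn_integral_multc nn_integral_gaussian Z2[symmetric] mult_ac)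
  have "(\<integral>\<^sup>+x. \<integral>\<^sup>+z. h (x + s *\<^sub>R z) * ?g z \<partial>lborel \<partial>lborel)
      = (\<integral>\<^sup>+z. \<integral>\<^sup>+x. h (x + s *\<^sub>R z) * ?g z \<partial>lborel \<partial>lborel)"
    by (rule lborel_pair.Fubini'[symmetric]) measurable
  also have "\<dots> = (\<integral>\<^sup>+z. (\<integral>\<^sup>+x. h x \<partial>lborel) * ?g z \<partial>lborel)"
  proof (intro nn_integral_cong)
    fix z
    have "(\<integral>\<^sup>+x. h (x + s *\<^sub>R z) \<partial>lborel) = (\<integral>\<^sup>+x. h x \<partial>lborel)"
      using nn_integral_lborel_affine[of h 1 "s *\<^sub>R z"] by (simp add: add.commute)
    then show "(\<integral>\<^sup>+x. h (x + s *\<^sub>R z) * ?g z \<partial>lborel) = (\<integral>\<^sup>+x. h x \<partial>lborel) * ?g z"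
      by (simp add: nn_integral_multc)
  qed
  also have "\<dots> = (\<integral>\<^sup>+x. h x \<partial>lborel) * ennreal ?Z"
    by (simp add: nn_integral_cmult nn_integral_gaussian)
  finally show ?snd
    by (subst nn_integral_gauss_kernel[OF _ s])
       (simp_all add: borel_prod[symmetric] Z2[symmetric] mult_ac)
qed

text \<open>The squared modulus of the transform is a double integral of
  \<open>f x * cnj (f y)\<close> against \<open>iexp ((y - x) \<bullet> \<xi>)\<close>. The Gaussian
  weight makes the integrand absolutely integrable jointly in frequency and both space variables, so
  the frequency may be integrated first, which produces the kernel. The left side is real, and the
  real part of \<open>f x * cnj (f y)\<close> is the inner product of complex numbers as plane
  vectors.\<close>

lemma integral_gaussian_fourier_sq:
  fixes f :: "'a::euclidean_space \<Rightarrow> complex"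
  assumes f: "integrable lborel f" and s: "0 < s"
  shows "integrable lborel (\<lambda>\<xi>. (norm (fourier f \<xi>))\<^sup>2 * exp (- (s * norm \<xi>)\<^sup>2 / 2))"
    and "integrable lborel (\<lambda>p. gauss_kernel s (snd p - fst p) * (f (fst p) \<bullet> f (snd p)))"
    and "(LINT \<xi>|lborel. (norm (fourier f \<xi>))\<^sup>2 * exp (- (s * norm \<xi>)\<^sup>2 / 2))
      = (LINT p|lborel. gauss_kernel s (snd p - fst p) * (f (fst p) \<bullet> f (snd p)))"
proof -
  have fm[measurable]: "f \<in> borel_measurable borel"
    using f by auto
  define F where "F p = f (fst p) * cnj (f (snd p))" for p :: "'a \<times> 'a"
  define \<gamma> where "\<gamma> \<xi> = complex_of_real (exp (- (s * norm \<xi>)\<^sup>2 / 2))" for \<xi> :: 'a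
  define h where "h \<xi> p = \<gamma> \<xi> * (iexp ((snd p - fst p) \<bullet> \<xi>) * F p)" for \<xi> :: 'a and p :: "'a \<times> 'a"
  have F: "integrable lborel F"
    unfolding F_def[abs_def] using f by (intro integrable_lborel_pair_mult integrable_cnj)
  then have [measurable]: "F \<in> borel_measurable borel" by auto
  have \<gamma>: "integrable lborel \<gamma>"
    unfolding \<gamma>_def[abs_def] complex_of_real_integrable_eq using s by (rule integrable_gaussian)
  have [measurable]: "\<gamma> \<in> borel_measurable borel" using \<gamma> by auto
  have h: "integrable (lborel \<Otimes>\<^sub>M lborel) (case_prod h)"
  proof (rule Bochner_Integration.integrable_bound)
    show "integrable (lborel \<Otimes>\<^sub>M lborel) (\<lambda>q. \<gamma> (fst q) * F (snd q))"
      using integrable_lborel_pair_mult[OF \<gamma> F] by (simp add: lborel_prod)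
    have [measurable]: "(fst :: 'a \<times> 'a \<times> 'a \<Rightarrow> 'a) \<in> borel \<rightarrow>\<^sub>M borel"
        "(snd :: 'a \<times> 'a \<times> 'a \<Rightarrow> 'a \<times> 'a) \<in> borel \<rightarrow>\<^sub>M borel"
        "(fst :: 'a \<times> 'a \<Rightarrow> 'a) \<in> borel \<rightarrow>\<^sub>M borel"
        "(snd :: 'a \<times> 'a \<Rightarrow> 'a) \<in> borel \<rightarrow>\<^sub>M borel"
      by (auto intro!: borel_measurable_continuous_onI continuous_intros)
    have "case_prod h \<in> borel_measurable borel"
      unfolding h_def[abs_def] split_beta' by measurable
    then show "case_prod h \<in> borel_measurable (lborel \<Otimes>\<^sub>M lborel)"
      by (simp add: lborel_prod)
  qed (auto simp: h_def norm_mult)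
  have inner_p: "(LINT p|lborel. h \<xi> p) = complex_of_real ((norm (fourier f \<xi>))\<^sup>2 * exp (- (s * norm \<xi>)\<^sup>2 / 2))" for \<xi>
  proof -
    let ?g = "\<lambda>x. iexp (- (x \<bullet> \<xi>)) * f x"
    have g: "integrable lborel ?g"
      by (rule Bochner_Integration.integrable_bound[OF f]) (auto simp: norm_mult)
    have eq: "h \<xi> p = \<gamma> \<xi> * (?g (fst p) * cnj (?g (snd p)))" for p
    proof -
      have "iexp ((snd p - fst p) \<bullet> \<xi>) = iexp (- (fst p \<bullet> \<xi>)) * cnj (iexp (- (snd p \<bullet> \<xi>)))"
        by (simp add: exp_cnj mult_exp_exp inner_diff_left algebra_simps)
      then show ?thesis by (simp add: h_def F_def mult_ac)
    qed
    have "(LINT p|lborel. h \<xi> p) = \<gamma> \<xi> * (integral\<^sup>L lborel ?g * integral\<^sup>L lborel (\<lambda>x. cnj (?g x)))"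
      unfolding eq integral_mult_right_zero integral_lborel_pair_mult[OF g integrable_cnj[OF g]] ..
    also have "\<dots> = \<gamma> \<xi> * (fourier f \<xi> * cnj (fourier f \<xi>))"
      unfolding fourier_borel[OF fm] Bochner_Integration.integral_cnj ..
    finally show ?thesis
      by (simp add: \<gamma>_def complex_norm_square[symmetric] del: of_real_power)
  qed
  have inner_\<xi>: "(LINT \<xi>|lborel. h \<xi> p) = complex_of_real (gauss_kernel s (snd p - fst p)) * F p" for p
  proof -
    have "(LINT \<xi>|lborel. h \<xi> p) = (LINT \<xi>|lborel. iexp ((snd p - fst p) \<bullet> \<xi>) * \<gamma> \<xi>) * F p"
      by (subst integral_mult_left_zero[symmetric]) (simp add: h_def mult_ac)
    then show ?thesis
      unfolding \<gamma>_def gaussian_fourier_scaled(2)[OF s] gauss_kernel_def .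
  qed
  have Re_F: "Re (complex_of_real c * F p) = c * (f (fst p) \<bullet> f (snd p))" for c p
    by (simp add: F_def inner_complex_def)
  have "integrable lborel (\<lambda>\<xi>. LINT p|lborel. h \<xi> p)"
    using lborel_pair.integrable_fst[OF h] .
  then show "integrable lborel (\<lambda>\<xi>. (norm (fourier f \<xi>))\<^sup>2 * exp (- (s * norm \<xi>)\<^sup>2 / 2))"
    unfolding inner_p complex_of_real_integrable_eq .
  have int_p: "integrable lborel (\<lambda>p. complex_of_real (gauss_kernel s (snd p - fst p)) * F p)"
    using lborel_pair.integrable_snd[OF h] unfolding inner_\<xi> .
  show "integrable lborel (\<lambda>p. gauss_kernel s (snd p - fst p) * (f (fst p) \<bullet> f (snd p)))"
    using integrable_Re[OF int_p] unfolding Re_F .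
  have "(LINT \<xi>|lborel. (norm (fourier f \<xi>))\<^sup>2 * exp (- (s * norm \<xi>)\<^sup>2 / 2)) = Re (LINT \<xi>|lborel. LINT p|lborel. h \<xi> p)"
    unfolding inner_p integral_complex_of_real by simp
  also have "\<dots> = Re (LINT p|lborel. complex_of_real (gauss_kernel s (snd p - fst p)) * F p)"
    using lborel_pair.Fubini_integral[OF h] unfolding inner_\<xi> by simp
  also have "\<dots> = (LINT p|lborel. gauss_kernel s (snd p - fst p) * (f (fst p) \<bullet> f (snd p)))"
    using integral_Re[OF int_p] unfolding Re_F by simp
  finally show "(LINT \<xi>|lborel. (norm (fourier f \<xi>))\<^sup>2 * exp (- (s * norm \<xi>)\<^sup>2 / 2))
      = (LINT p|lborel. gauss_kernel s (snd p - fst p) * (f (fst p) \<bullet> f (snd p)))" .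
qed

text \<open>Extended-valued, unlike \<open>L2_norm\<close>, so that it is meaningful before
  integrability is known, suits Fatou's lemma and matches the integral in
  \<open>fourier_plancherel\<close>.\<close>

definition sq_norm :: "('a::euclidean_space \<Rightarrow> complex) \<Rightarrow> ennreal" where
  "sq_norm f = (\<integral>\<^sup>+x. ennreal ((norm (f x))\<^sup>2) \<partial>lebesgue)"

lemma sq_norm_lborel: "sq_norm f = (\<integral>\<^sup>+x. ennreal ((norm (f x))\<^sup>2) \<partial>lborel)"
  by (simp add: sq_norm_def nn_integral_completion)

text \<open>Expanding \<open>|f x + f y|^2\<close> under the kernel gives two square terms, each
  equal to the mass of the kernel times \<open>sq_norm f\<close>, and a cross term that is twice the
  weighted integral of the squared transform. The square terms stand on the left so that nothing is
  subtracted in \<open>ennreal\<close>.\<close>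

lemma gaussian_parallelogram:
  fixes f :: "'a::euclidean_space \<Rightarrow> complex"
  assumes f: "integrable lborel f" and L2: "sq_norm f < \<infinity>" and s: "0 < s"
  shows "2 * (\<integral>\<^sup>+\<xi>. ennreal ((norm (fourier f \<xi>))\<^sup>2 * exp (- (s * norm \<xi>)\<^sup>2 / 2)) \<partial>lborel)
      + 2 * (ennreal ((gauss_mass TYPE('a))\<^sup>2) * sq_norm f)
    = ennreal (gauss_mass TYPE('a)) * (\<integral>\<^sup>+x. \<integral>\<^sup>+z. ennreal ((norm (f x + f (x + s *\<^sub>R z)))\<^sup>2)
        * ennreal (exp (- (norm z)\<^sup>2 / 2)) \<partial>lborel \<partial>lborel)"
proof -
  have [measurable]: "f \<in> borel_measurable borel"
    using f by auto
  have [measurable]: "(fst :: 'a \<times> 'a \<Rightarrow> 'a) \<in> borel \<rightarrow>\<^sub>M borel"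
      "(snd :: 'a \<times> 'a \<Rightarrow> 'a) \<in> borel \<rightarrow>\<^sub>M borel"
    by (auto intro!: borel_measurable_continuous_onI continuous_intros)
  define K where "K p = gauss_kernel s (snd p - fst p)" for p :: "'a \<times> 'a"
  have K: "0 \<le> K p" for p
    unfolding K_def using gauss_kernel_nonneg[OF s] .
  have [measurable]: "K \<in> borel_measurable borel"
    unfolding K_def[abs_def] by measurable
  let ?C = "ennreal ((gauss_mass TYPE('a))\<^sup>2) * sq_norm f"
  have fin: "?C < \<infinity>"
    using L2 by (simp add: ennreal_mult_less_top)
  have b1: "(\<integral>\<^sup>+p. ennreal ((norm (f (fst p)))\<^sup>2 * K p) \<partial>lborel) = ?C"
    using nn_integral_gauss_kernel_fst[of "\<lambda>x. ennreal ((norm (f x))\<^sup>2)" s] s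
    by (simp add: K_def sq_norm_lborel ennreal_mult')
  have b2: "(\<integral>\<^sup>+p. ennreal ((norm (f (snd p)))\<^sup>2 * K p) \<partial>lborel) = ?C"
    using nn_integral_gauss_kernel_snd[of "\<lambda>x. ennreal ((norm (f x))\<^sup>2)" s] s
    by (simp add: K_def sq_norm_lborel ennreal_mult')
  have i1: "integrable lborel (\<lambda>p. (norm (f (fst p)))\<^sup>2 * K p)"
    by (intro integrableI_nonneg) (use fin K in \<open>auto simp: b1\<close>)
  have i2: "integrable lborel (\<lambda>p. (norm (f (snd p)))\<^sup>2 * K p)"
    by (intro integrableI_nonneg) (use fin K in \<open>auto simp: b2\<close>)
  have i3: "integrable lborel (\<lambda>p. K p * (f (fst p) \<bullet> f (snd p)))"
    unfolding K_def by (rule integral_gaussian_fourier_sq[OF f s])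
  define J where "J = (LINT p|lborel. K p * (f (fst p) \<bullet> f (snd p)))"
  have J: "J = (LINT \<xi>|lborel. (norm (fourier f \<xi>))\<^sup>2 * exp (- (s * norm \<xi>)\<^sup>2 / 2))"
    unfolding J_def K_def by (rule integral_gaussian_fourier_sq(3)[OF f s, symmetric])
  \<comment> \<open>The sign of the cross term is visible only on the frequency side; it is what
    allows the sum below to be split into \<open>ennreal\<close> summands.\<close>
  then have "0 \<le> J" by simp
  have J': "(\<integral>\<^sup>+\<xi>. ennreal ((norm (fourier f \<xi>))\<^sup>2 * exp (- (s * norm \<xi>)\<^sup>2 / 2)) \<partial>lborel) = ennreal J"
    unfolding J by (intro nn_integral_eq_integral integral_gaussian_fourier_sq[OF f s]) auto
  have expand: "(norm (f (fst p) + f (snd p)))\<^sup>2 * K p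
      = (norm (f (fst p)))\<^sup>2 * K p + (norm (f (snd p)))\<^sup>2 * K p + 2 * (K p * (f (fst p) \<bullet> f (snd p)))" for p
    by (simp add: power2_norm_eq_inner inner_add_left inner_add_right inner_commute algebra_simps)
  have c1: "ennreal (LINT p|lborel. (norm (f (fst p)))\<^sup>2 * K p) = ?C"
    using nn_integral_eq_integral[OF i1] K b1 by simp
  have c2: "ennreal (LINT p|lborel. (norm (f (snd p)))\<^sup>2 * K p) = ?C"
    using nn_integral_eq_integral[OF i2] K b2 by simp
  have "(\<integral>\<^sup>+p. ennreal ((norm (f (fst p) + f (snd p)))\<^sup>2 * K p) \<partial>lborel)
      = ennreal (LINT p|lborel. (norm (f (fst p) + f (snd p)))\<^sup>2 * K p)"
  proof (rule nn_integral_eq_integral)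
    show "integrable lborel (\<lambda>p. (norm (f (fst p) + f (snd p)))\<^sup>2 * K p)"
      unfolding expand using i1 i2 i3 by simp
  qed (auto intro!: AE_I2 mult_nonneg_nonneg K)
  also have "(LINT p|lborel. (norm (f (fst p) + f (snd p)))\<^sup>2 * K p)
      = (LINT p|lborel. (norm (f (fst p)))\<^sup>2 * K p) + (LINT p|lborel. (norm (f (snd p)))\<^sup>2 * K p) + 2 * J"
    unfolding expand J_def using i1 i2 i3 by simp
  also have "ennreal \<dots> = ennreal (LINT p|lborel. (norm (f (fst p)))\<^sup>2 * K p)
      + ennreal (LINT p|lborel. (norm (f (snd p)))\<^sup>2 * K p) + ennreal (2 * J)"
  proof -
    have "0 \<le> (LINT p|lborel. (norm (f (fst p)))\<^sup>2 * K p)" "0 \<le> (LINT p|lborel. (norm (f (snd p)))\<^sup>2 * K p)"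
      using K by (auto intro!: Bochner_Integration.integral_nonneg)
    with \<open>0 \<le> J\<close> show ?thesis by (simp add: ennreal_plus)
  qed
  also have "\<dots> = ?C + ?C + ennreal (2 * J)"
    unfolding c1 c2 ..
  also have "\<dots> = 2 * ennreal J + 2 * ?C"
  proof -
    have "ennreal (2 * J) = ennreal J + ennreal J"
      using \<open>0 \<le> J\<close> by (simp flip: ennreal_plus)
    then show ?thesis by (simp only: mult_2 add_ac)
  qed
  finally have "(\<integral>\<^sup>+p. ennreal ((norm (f (fst p) + f (snd p)))\<^sup>2 * K p) \<partial>lborel) = 2 * ennreal J + 2 * ?C" .
  moreover have "(\<integral>\<^sup>+p. ennreal ((norm (f (fst p) + f (snd p)))\<^sup>2 * K p) \<partial>lborel)
      = ennreal (gauss_mass TYPE('a)) * (\<integral>\<^sup>+x. \<integral>\<^sup>+z. ennreal ((norm (f x + f (x + s *\<^sub>R z)))\<^sup>2)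
        * ennreal (exp (- (norm z)\<^sup>2 / 2)) \<partial>lborel \<partial>lborel)"
    using nn_integral_gauss_kernel[of "\<lambda>p. ennreal ((norm (f (fst p) + f (snd p)))\<^sup>2)" s] s
    by (simp add: K_def ennreal_mult')
  ultimately show ?thesis
    unfolding J' by simp
qed

lemma ennreal_add_right_le_imp_le:
  fixes a b c :: ennreal
  assumes "a + c \<le> b + c" "c < \<infinity>"
  shows "a \<le> b"
  using assms ennreal_add_left_cancel_le[of c a b] by (auto simp: add.commute)

lemma norm_add_sq_le: "(norm (x + y :: 'a::real_normed_vector))\<^sup>2 \<le> 2 * (norm x)\<^sup>2 + 2 * (norm y)\<^sup>2"
proof -
  have "(norm (x + y))\<^sup>2 \<le> (norm x + norm y)\<^sup>2"
    by (intro power_mono norm_triangle_ineq) auto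
  also have "\<dots> \<le> 2 * (norm x)\<^sup>2 + 2 * (norm y)\<^sup>2"
    using zero_le_power2[of "norm x - norm y"] by (simp add: power2_eq_square algebra_simps)
  finally show ?thesis .
qed

text \<open>Bounding \<open>|a + b|^2\<close> by \<open>2 |a|^2 + 2 |b|^2\<close> in the
  parallelogram identity gives \<open>2 J + 2 C <= 4 C\<close>, and the finite \<open>2 C\<close>
  cancels.\<close>

lemma fourier_sq_norm_gaussian_le:
  fixes f :: "'a::euclidean_space \<Rightarrow> complex"
  assumes f: "integrable lborel f" and L2: "sq_norm f < \<infinity>" and s: "0 < s"
  shows "(\<integral>\<^sup>+\<xi>. ennreal ((norm (fourier f \<xi>))\<^sup>2 * exp (- (s * norm \<xi>)\<^sup>2 / 2)) \<partial>lborel)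
    \<le> ennreal ((gauss_mass TYPE('a))\<^sup>2) * sq_norm f" (is "?J \<le> ?C")
proof -
  have [measurable]: "f \<in> borel_measurable borel"
    using f by auto
  have [measurable]: "(fst :: 'a \<times> 'a \<Rightarrow> 'a) \<in> borel \<rightarrow>\<^sub>M borel"
      "(snd :: 'a \<times> 'a \<Rightarrow> 'a) \<in> borel \<rightarrow>\<^sub>M borel"
    by (auto intro!: borel_measurable_continuous_onI continuous_intros)
  let ?K = "\<lambda>p::'a\<times>'a. ennreal (gauss_kernel s (snd p - fst p))"
  let ?f2 = "\<lambda>x. ennreal ((norm (f x))\<^sup>2)"
  have "2 * ?J + 2 * ?C = (\<integral>\<^sup>+p. ennreal ((norm (f (fst p) + f (snd p)))\<^sup>2) * ?K p \<partial>lborel)"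
    unfolding gaussian_parallelogram[OF assms] by (subst nn_integral_gauss_kernel[OF _ s]) auto
  also have "\<dots> \<le> (\<integral>\<^sup>+p. 2 * (?f2 (fst p) * ?K p) + 2 * (?f2 (snd p) * ?K p) \<partial>lborel)"
  proof (intro nn_integral_mono)
    fix p
    have "ennreal ((norm (f (fst p) + f (snd p)))\<^sup>2) \<le> ennreal (2 * (norm (f (fst p)))\<^sup>2 + 2 * (norm (f (snd p)))\<^sup>2)"
      by (intro ennreal_leI norm_add_sq_le)
    also have "\<dots> = 2 * ?f2 (fst p) + 2 * ?f2 (snd p)"
      by (simp add: ennreal_mult')
    finally show "ennreal ((norm (f (fst p) + f (snd p)))\<^sup>2) * ?K p \<le> 2 * (?f2 (fst p) * ?K p) + 2 * (?f2 (snd p) * ?K p)"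
      by (metis (no_types, lifting) distrib_right mult.assoc mult_right_mono zero_le)
  qed
  also have "\<dots> = 2 * ?C + 2 * ?C"
    using nn_integral_gauss_kernel_fst[of ?f2 s] nn_integral_gauss_kernel_snd[of ?f2 s] s
    by (simp add: nn_integral_add nn_integral_cmult sq_norm_lborel)
  finally have le: "2 * ?J + 2 * ?C \<le> 2 * ?C + 2 * ?C" .
  have fin: "2 * ?C < \<infinity>"
    using L2 by (simp add: ennreal_mult_less_top)
  have "2 * ?J \<le> 2 * ?C"
    by (rule ennreal_add_right_le_imp_le[OF le fin])
  then show ?thesis
    by (subst (asm) ennreal_mult_le_mult_iff) auto
qed

lemma tendsto_gaussian_1:
  "(\<lambda>k. exp (- (1 / real (Suc k) * norm (\<xi>::'a::euclidean_space))\<^sup>2 / 2)) \<longlonglongrightarrow> 1"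
proof -
  have "(\<lambda>k. exp (- (1 / real (Suc k) * norm \<xi>)\<^sup>2 / 2)) \<longlonglongrightarrow> exp (- (0 * norm \<xi>)\<^sup>2 / 2)"
    by (intro tendsto_intros LIMSEQ_Suc lim_1_over_n) auto
  then show ?thesis by simp
qed

text \<open>The weight tends to 1 along \<open>s = 1 / (k + 1)\<close>, and Fatou's lemma removes
  it. The constant is still the sharp one here.\<close>

lemma sq_norm_fourier_le:
  fixes f :: "'a::euclidean_space \<Rightarrow> complex"
  assumes f: "integrable lborel f" and L2: "sq_norm f < \<infinity>"
  shows "sq_norm (fourier f) \<le> ennreal ((gauss_mass TYPE('a))\<^sup>2) * sq_norm f"
proof -
  have [measurable]: "f \<in> borel_measurable borel"
    using f by auto
  let ?u = "\<lambda>k \<xi>. ennreal ((norm (fourier f \<xi>))\<^sup>2 * exp (- (1 / real (Suc k) * norm \<xi>)\<^sup>2 / 2))"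
  have lim: "(\<lambda>k. ?u k \<xi>) \<longlonglongrightarrow> ennreal ((norm (fourier f \<xi>))\<^sup>2)" for \<xi>
    using tendsto_mult[OF tendsto_const tendsto_gaussian_1, of "(norm (fourier f \<xi>))\<^sup>2" \<xi>]
    by (intro tendsto_ennrealI) simp
  have "sq_norm (fourier f) = (\<integral>\<^sup>+\<xi>. liminf (\<lambda>k. ?u k \<xi>) \<partial>lborel)"
    unfolding sq_norm_lborel by (intro nn_integral_cong lim_imp_Liminf[symmetric] lim) simp
  also have "\<dots> \<le> liminf (\<lambda>k. \<integral>\<^sup>+\<xi>. ?u k \<xi> \<partial>lborel)"
    by (rule nn_integral_liminf) measurable
  also have "\<dots> \<le> ennreal ((gauss_mass TYPE('a))\<^sup>2) * sq_norm f"
    by (intro Liminf_le always_eventually allI fourier_sq_norm_gaussian_le f L2) auto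
  finally show ?thesis .
qed

text \<open>
  As the regularisation parameter tends to 0, Fatou's lemma bounds the right-hand side of
  \<open>gaussian_parallelogram\<close> from below by four times the squared norm; no domination is needed.
\<close>

lemma sq_norm_le_fourier_continuous:
  fixes f :: "'a::euclidean_space \<Rightarrow> complex"
  assumes f: "integrable lborel f" and L2: "sq_norm f < \<infinity>" and cont: "continuous_on UNIV f"
  shows "ennreal ((gauss_mass TYPE('a))\<^sup>2) * sq_norm f \<le> sq_norm (fourier f)"
proof -
  have [measurable]: "f \<in> borel_measurable borel"
    using f by auto
  let ?Z = "ennreal (gauss_mass TYPE('a))"
  let ?C = "ennreal ((gauss_mass TYPE('a))\<^sup>2) * sq_norm f"
  let ?g = "\<lambda>z::'a. ennreal (gauss_mass TYPE('a) * exp (- (norm z)\<^sup>2 / 2))"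
  let ?s = "\<lambda>k. 1 / real (Suc k)"
  let ?u = "\<lambda>k x z. ennreal ((norm (f x + f (x + ?s k *\<^sub>R z)))\<^sup>2) * ?g z"
  have Z2: "ennreal ((gauss_mass TYPE('a))\<^sup>2) = ?Z * ?Z"
    using gauss_mass_pos[where 'a='a] by (simp add: ennreal_mult'[symmetric] power2_eq_square)
  have g: "?g z = ?Z * ennreal (exp (- (norm z)\<^sup>2 / 2))" for z
    using gauss_mass_pos[where 'a='a] by (simp add: ennreal_mult')
  have [measurable]: "case_prod (?u k) \<in> borel_measurable (borel \<Otimes>\<^sub>M borel)" for k
    by measurable
  have lim: "(\<lambda>k. ?u k x z) \<longlonglongrightarrow> ennreal ((norm (f x + f x))\<^sup>2) * ?g z" for x z
  proof -
    have "(\<lambda>k. x + ?s k *\<^sub>R z) \<longlonglongrightarrow> x + 0 *\<^sub>R z"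
      by (intro tendsto_intros LIMSEQ_Suc lim_1_over_n)
    \<comment> \<open>Continuity of \<open>f\<close> enters only here: the shifted values must
      converge for all \<open>x\<close> and \<open>z\<close>. This is why general functions are
      reached by approximation afterwards.\<close>
    then have "(\<lambda>k. f (x + ?s k *\<^sub>R z)) \<longlonglongrightarrow> f x"
      using cont by (auto intro: continuous_on_tendsto_compose)
    then have "(\<lambda>k. ennreal ((norm (f x + f (x + ?s k *\<^sub>R z)))\<^sup>2 * (gauss_mass TYPE('a) * exp (- (norm z)\<^sup>2 / 2))))
        \<longlonglongrightarrow> ennreal ((norm (f x + f x))\<^sup>2 * (gauss_mass TYPE('a) * exp (- (norm z)\<^sup>2 / 2)))"
      by (intro tendsto_intros)
    then show ?thesis by (simp add: ennreal_mult')
  qed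
  have "(\<integral>\<^sup>+x. \<integral>\<^sup>+z. ennreal ((norm (f x + f x))\<^sup>2) * ?g z \<partial>lborel \<partial>lborel)
      = (\<integral>\<^sup>+x. \<integral>\<^sup>+z. liminf (\<lambda>k. ?u k x z) \<partial>lborel \<partial>lborel)"
    by (intro nn_integral_cong lim_imp_Liminf[symmetric] lim) simp
  also have "\<dots> \<le> (\<integral>\<^sup>+x. liminf (\<lambda>k. \<integral>\<^sup>+z. ?u k x z \<partial>lborel) \<partial>lborel)"
    by (intro nn_integral_mono nn_integral_liminf) measurable
  also have "\<dots> \<le> liminf (\<lambda>k. \<integral>\<^sup>+x. \<integral>\<^sup>+z. ?u k x z \<partial>lborel \<partial>lborel)"
    by (rule nn_integral_liminf) measurable
  finally have fatou: "(\<integral>\<^sup>+x. \<integral>\<^sup>+z. ennreal ((norm (f x + f x))\<^sup>2) * ?g z \<partial>lborel \<partial>lborel)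
      \<le> liminf (\<lambda>k. \<integral>\<^sup>+x. \<integral>\<^sup>+z. ?u k x z \<partial>lborel \<partial>lborel)" .
  have four: "ennreal ((norm (f x + f x))\<^sup>2) = 4 * ennreal ((norm (f x))\<^sup>2)" for x
  proof -
    have "(norm (f x + f x))\<^sup>2 = 4 * (norm (f x))\<^sup>2"
      by (simp add: mult_2[symmetric] norm_mult power_mult_distrib)
    then show ?thesis by (simp add: ennreal_mult')
  qed
  have "4 * ?C = (\<integral>\<^sup>+x. \<integral>\<^sup>+z. ennreal ((norm (f x + f x))\<^sup>2) * ?g z \<partial>lborel \<partial>lborel)"
  proof -
    have "(\<integral>\<^sup>+z. ?g z \<partial>lborel) = ?Z * ?Z"
      unfolding g by (simp add: nn_integral_cmult nn_integral_gaussian)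
    moreover have "(\<integral>\<^sup>+x. ennreal ((norm (f x + f x))\<^sup>2) \<partial>lborel) = 4 * sq_norm f"
      unfolding four sq_norm_lborel by (rule nn_integral_cmult) measurable
    moreover have "4 * ?C = (4 * sq_norm f) * (?Z * ?Z)"
      by (simp only: Z2 mult_ac)
    ultimately show ?thesis
      by (simp add: nn_integral_cmult nn_integral_multc)
  qed
  also have "\<dots> \<le> liminf (\<lambda>k. \<integral>\<^sup>+x. \<integral>\<^sup>+z. ?u k x z \<partial>lborel \<partial>lborel)"
    by (rule fatou)
  also have "\<dots> \<le> 2 * sq_norm (fourier f) + 2 * ?C"
  proof (intro Liminf_le always_eventually allI)
    fix k
    have "(\<integral>\<^sup>+x. \<integral>\<^sup>+z. ?u k x z \<partial>lborel \<partial>lborel) = ?Z * (\<integral>\<^sup>+x. \<integral>\<^sup>+z.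
        ennreal ((norm (f x + f (x + ?s k *\<^sub>R z)))\<^sup>2) * ennreal (exp (- (norm z)\<^sup>2 / 2)) \<partial>lborel \<partial>lborel)"
      by (subst nn_integral_cmult[symmetric], simp, intro nn_integral_cong, subst nn_integral_cmult[symmetric], simp)
         (simp only: g mult_ac)
    also have "\<dots> = 2 * (\<integral>\<^sup>+\<xi>. ennreal ((norm (fourier f \<xi>))\<^sup>2 * exp (- (?s k * norm \<xi>)\<^sup>2 / 2)) \<partial>lborel) + 2 * ?C"
      by (rule gaussian_parallelogram[symmetric]) (use f L2 in auto)
    also have "\<dots> \<le> 2 * sq_norm (fourier f) + 2 * ?C"
      unfolding sq_norm_lborel[of "fourier f"]
      by (intro add_mono mult_left_mono nn_integral_mono ennreal_leI) (auto simp: mult_left_le)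
    finally show "(\<integral>\<^sup>+x. \<integral>\<^sup>+z. ?u k x z \<partial>lborel \<partial>lborel) \<le> 2 * sq_norm (fourier f) + 2 * ?C" .
  qed simp
  finally have "2 * ?C + 2 * ?C \<le> 2 * sq_norm (fourier f) + 2 * ?C"
    by (simp add: distrib_right[symmetric])
  moreover have "2 * ?C < \<infinity>"
    using L2 by (simp add: ennreal_mult_less_top)
  ultimately have "2 * ?C \<le> 2 * sq_norm (fourier f)"
    by (rule ennreal_add_right_le_imp_le)
  then show ?thesis
    by (subst (asm) ennreal_mult_le_mult_iff) auto
qed

section \<open>Approximation by continuous functions in the squared norm\<close>

lemma tendsto_sq_norm_0:
  fixes h :: "nat \<Rightarrow> 'a::euclidean_space \<Rightarrow> complex"
  assumes [measurable]: "\<And>j. h j \<in> borel_measurable borel"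
    and w: "integrable lborel w" and le: "\<And>j x. (norm (h j x))\<^sup>2 \<le> w x"
    and lim: "AE x in lborel. (\<lambda>j. h j x) \<longlonglongrightarrow> 0"
  shows "(\<lambda>j. sq_norm (h j)) \<longlonglongrightarrow> 0"
proof -
  have w0: "0 \<le> w x" for x
    using le[of 0 x] zero_le_power2 order_trans by blast
  have "(\<lambda>j. \<integral>\<^sup>+x. ennreal ((norm (h j x))\<^sup>2) \<partial>lborel) \<longlonglongrightarrow> (\<integral>\<^sup>+x. 0 \<partial>(lborel::'a measure))"
  proof (rule nn_integral_dominated_convergence)
    show "(\<integral>\<^sup>+x. ennreal (w x) \<partial>lborel) < \<infinity>"
      using nn_integral_eq_integral[OF w] w0 by simp
    show "AE x in lborel. (\<lambda>j. ennreal ((norm (h j x))\<^sup>2)) \<longlonglongrightarrow> 0"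
      using lim
    proof eventually_elim
      case (elim x)
      have "(\<lambda>j. ennreal ((norm (h j x))\<^sup>2)) \<longlonglongrightarrow> ennreal ((norm (0::complex))\<^sup>2)"
        by (intro tendsto_intros elim)
      then show ?case by simp
    qed
    show "(\<lambda>x. ennreal (w x)) \<in> borel_measurable lborel" using w by auto
  qed (use le in \<open>auto intro: ennreal_leI\<close>)
  then show ?thesis
    by (simp add: sq_norm_lborel)
qed

text \<open>Replaces the triangle inequality for squared norms. Its factor 2 is the source of the
  later constants 4 and 8.\<close>

lemma sq_norm_add_le:
  assumes [measurable]: "f \<in> borel_measurable lebesgue" "g \<in> borel_measurable lebesgue"
  shows "sq_norm (\<lambda>x. f x + g x) \<le> 2 * sq_norm f + 2 * sq_norm g"
proof -
  have "sq_norm (\<lambda>x. f x + g x) \<le> (\<integral>\<^sup>+x. 2 * ennreal ((norm (f x))\<^sup>2) + 2 * ennreal ((norm (g x))\<^sup>2) \<partial>lebesgue)"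
    unfolding sq_norm_def
  proof (intro nn_integral_mono)
    fix x
    have "ennreal ((norm (f x + g x))\<^sup>2) \<le> ennreal (2 * (norm (f x))\<^sup>2 + 2 * (norm (g x))\<^sup>2)"
      by (intro ennreal_leI norm_add_sq_le)
    then show "ennreal ((norm (f x + g x))\<^sup>2) \<le> 2 * ennreal ((norm (f x))\<^sup>2) + 2 * ennreal ((norm (g x))\<^sup>2)"
      by (simp add: ennreal_mult')
  qed
  also have "\<dots> = 2 * sq_norm f + 2 * sq_norm g"
    unfolding sq_norm_def by (simp add: nn_integral_add nn_integral_cmult)
  finally show ?thesis .
qed

text \<open>The radial retraction onto the disc of radius \<open>M\<close>: the identity inside,
  rescaling to modulus \<open>M\<close> outside. The form with \<open>max\<close> makes continuity
  evident.\<close>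

definition truncate :: "real \<Rightarrow> complex \<Rightarrow> complex" where
  "truncate M z = complex_of_real (M / max M (norm z)) * z"

lemma norm_truncate_le:
  assumes "0 < M"
  shows "norm (truncate M z) \<le> norm z" "norm (truncate M z) \<le> M"
proof -
  have eq: "norm (truncate M z) = M / max M (norm z) * norm z"
    using assms by (simp add: truncate_def norm_mult norm_divide)
  have "M / max M (norm z) \<le> 1" using assms by simp
  from mult_right_mono[OF this, of "norm z"] show "norm (truncate M z) \<le> norm z"
    unfolding eq by simp
  have "norm z / max M (norm z) \<le> 1" using assms by simp
  from mult_left_mono[OF this, of M] show "norm (truncate M z) \<le> M"
    unfolding eq using assms by simp
qed

lemma continuous_on_truncate: "0 < M \<Longrightarrow> continuous_on UNIV (truncate M)"
  unfolding truncate_def[abs_def] by (intro continuous_intros) auto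

text \<open>The operation \<open>h k\<close> truncates the values at height \<open>k + 1\<close> and
  multiplies by a wide Gaussian; \<open>h k f\<close> tends to \<open>f\<close> as \<open>k\<close>
  grows. A measurable \<open>f\<close> is an almost everywhere limit of continuous
  \<open>G j\<close>, about whose size nothing is known, but applying the same \<open>h k\<close> to
  them supplies a common integrable bound. Hence \<open>h k (G j)\<close> tends to
  \<open>h k f\<close> for fixed \<open>k\<close>, and it is continuous and integrable.\<close>

lemma continuous_approximation_sq_norm:
  fixes f :: "'a::euclidean_space \<Rightarrow> complex"
  assumes f[measurable]: "f \<in> borel_measurable borel" and L2: "sq_norm f < \<infinity>" and e: "0 < e"
  obtains g where "continuous_on UNIV g" "integrable lborel g" "sq_norm g < \<infinity>" "sq_norm (\<lambda>x. f x - g x) \<le> ennreal e"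
proof -
  let ?M = "\<lambda>k. real (Suc k)"
  define \<eta> :: "nat \<Rightarrow> 'a \<Rightarrow> real" where "\<eta> k x = exp (- (1 / ?M k * norm x)\<^sup>2 / 2)" for k x
  have \<eta>: "0 \<le> \<eta> k x" "\<eta> k x \<le> 1" for k x
    by (auto simp: \<eta>_def)
  have \<eta>_int: "integrable lborel (\<eta> k)" for k
    unfolding \<eta>_def[abs_def] by (rule integrable_gaussian) simp
  have \<eta>_cont: "continuous_on UNIV (\<eta> k)" for k
    unfolding \<eta>_def[abs_def] by (intro continuous_intros) auto
  note [measurable] = borel_measurable_continuous_onI[OF \<eta>_cont]
  define h where "h k q x = complex_of_real (\<eta> k x) * truncate (?M k) (q x)" for k q and x :: 'a
  have [measurable]: "truncate (?M k) \<in> borel_measurable borel" for k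
    by (intro borel_measurable_continuous_onI continuous_on_truncate) simp
  have h_meas [measurable]: "h k q \<in> borel_measurable borel" if [measurable]: "q \<in> borel_measurable borel" for k q
    unfolding h_def[abs_def] by measurable
  have h1: "norm (h k q x) \<le> norm (q x)" for k q x
    using \<eta>[of k x] norm_truncate_le(1)[of "?M k" "q x"]
      mult_mono[of "\<eta> k x" 1 "norm (truncate (?M k) (q x))" "norm (q x)"]
    by (simp add: h_def norm_mult)
  have h2: "norm (h k q x) \<le> ?M k * \<eta> k x" for k q x
    using \<eta>[of k x] norm_truncate_le(2)[of "?M k" "q x"]
      mult_left_mono[of "norm (truncate (?M k) (q x))" "?M k" "\<eta> k x"]
    by (simp add: h_def norm_mult mult.commute)
  \<comment> \<open>One factor of the Gaussian is given up so that the dominating function is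
    integrable by \<open>\<eta>_int\<close>; the bound does not depend on \<open>q\<close>.\<close>
  have h2': "(norm (h k q x))\<^sup>2 \<le> (?M k)\<^sup>2 * \<eta> k x" for k q x
  proof -
    have "(norm (h k q x))\<^sup>2 \<le> (?M k * \<eta> k x)\<^sup>2"
      using h2 by (intro power_mono) auto
    also have "\<dots> = (?M k)\<^sup>2 * (\<eta> k x * \<eta> k x)"
      by (simp add: power2_eq_square)
    also have "\<dots> \<le> (?M k)\<^sup>2 * \<eta> k x"
      using \<eta> by (intro mult_left_mono) (auto simp: mult_left_le)
    finally show ?thesis .
  qed
  have f2: "integrable lborel (\<lambda>x. 4 * (norm (f x))\<^sup>2)"
    using L2 by (intro integrable_mult_right integrableI_nonneg) (auto simp: sq_norm_lborel)
  have "(\<lambda>k. sq_norm (\<lambda>x. f x - h k f x)) \<longlonglongrightarrow> 0"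
  proof (rule tendsto_sq_norm_0[OF _ f2])
    fix k x
    have "norm (f x - h k f x) \<le> 2 * norm (f x)"
      using norm_triangle_ineq4[of "f x" "h k f x"] h1[of k f x] by simp
    then have "(norm (f x - h k f x))\<^sup>2 \<le> (2 * norm (f x))\<^sup>2"
      by (intro power_mono) auto
    then show "(norm (f x - h k f x))\<^sup>2 \<le> 4 * (norm (f x))\<^sup>2" by (simp add: power_mult_distrib)
  next
    show "AE x in lborel. (\<lambda>k. f x - h k f x) \<longlonglongrightarrow> 0"
    proof (intro AE_I2)
      fix x :: 'a
      have ev: "eventually (\<lambda>k. complex_of_real (\<eta> k x) * f x = h k f x) sequentially"
      proof -
        obtain N where "norm (f x) \<le> real N" using real_arch_simple by blast
        then have "truncate (?M k) (f x) = f x" if "N \<le> k" for k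
          using that by (simp add: truncate_def max_def)
        then show ?thesis
          unfolding h_def eventually_sequentially by (intro exI[of _ N]) auto
      qed
      have "(\<lambda>k. complex_of_real (\<eta> k x) * f x) \<longlonglongrightarrow> complex_of_real 1 * f x"
        unfolding \<eta>_def by (intro tendsto_intros tendsto_gaussian_1)
      from Lim_transform_eventually[OF this ev] have "(\<lambda>k. h k f x) \<longlonglongrightarrow> f x" by simp
      from tendsto_diff[OF tendsto_const[of "f x"] this] show "(\<lambda>k. f x - h k f x) \<longlonglongrightarrow> 0" by simp
    qed
  qed measurable
  \<comment> \<open>Two errors of size \<open>e / 4\<close>, each doubled by
    \<open>sq_norm_add_le\<close>, add up to \<open>e\<close>.\<close>
  moreover have e4: "0 < ennreal (e / 4)"
    using e by simp
  ultimately have "eventually (\<lambda>k. sq_norm (\<lambda>x. f x - h k f x) < ennreal (e / 4)) sequentially"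
    by (rule order_tendstoD(2))
  then obtain k where k: "sq_norm (\<lambda>x. f x - h k f x) < ennreal (e / 4)"
    by (auto simp: eventually_sequentially)
  have "f measurable_on UNIV"
    by (rule lebesgue_measurable_imp_measurable_on) (auto intro: measurable_completion)
  then obtain N G where N: "negligible N" and G: "\<And>j. continuous_on UNIV (G j)"
    and lim: "\<And>x. x \<notin> N \<Longrightarrow> (\<lambda>j. G j x) \<longlonglongrightarrow> f x"
    unfolding measurable_on_def by auto
  have [measurable]: "G j \<in> borel_measurable borel" for j
    using G by (rule borel_measurable_continuous_onI)
  have AE_N: "AE x in lborel. x \<notin> N"
    using AE_not_in[of N lebesgue] N unfolding negligible_iff_null_sets AE_completion_iff .
  have hk_cont: "continuous_on UNIV (h k q)" if "continuous_on UNIV q" for q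
    unfolding h_def[abs_def]
    by (intro continuous_intros \<eta>_cont continuous_on_compose2[OF continuous_on_truncate that]) auto
  have "(\<lambda>j. sq_norm (\<lambda>x. h k f x - h k (G j) x)) \<longlonglongrightarrow> 0"
  proof (rule tendsto_sq_norm_0)
    show "integrable lborel (\<lambda>x. 4 * ((?M k)\<^sup>2 * \<eta> k x))"
      by (intro integrable_mult_right \<eta>_int)
    fix j x
    have "(norm (h k f x - h k (G j) x))\<^sup>2 \<le> 2 * (norm (h k f x))\<^sup>2 + 2 * (norm (h k (G j) x))\<^sup>2"
      using norm_add_sq_le[of "h k f x" "- h k (G j) x"] by simp
    then show "(norm (h k f x - h k (G j) x))\<^sup>2 \<le> 4 * ((?M k)\<^sup>2 * \<eta> k x)"
      using h2'[of k f x] h2'[of k "G j" x] by linarith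
  next
    show "AE x in lborel. (\<lambda>j. h k f x - h k (G j) x) \<longlonglongrightarrow> 0"
      using AE_N
    proof eventually_elim
      case (elim x)
      have "(\<lambda>j. truncate (?M k) (G j x)) \<longlonglongrightarrow> truncate (?M k) (f x)"
        by (rule continuous_on_tendsto_compose[OF continuous_on_truncate lim[OF elim]]) auto
      then have "(\<lambda>j. h k f x - h k (G j) x) \<longlonglongrightarrow> h k f x - h k f x"
        unfolding h_def by (intro tendsto_intros)
      then show ?case by simp
    qed
  qed measurable
  from order_tendstoD(2)[OF this e4] obtain j where j: "sq_norm (\<lambda>x. h k f x - h k (G j) x) < ennreal (e / 4)"
    by (auto simp: eventually_sequentially)
  define g where "g = h k (G j)"
  have [measurable]: "g \<in> borel_measurable borel" unfolding g_def by measurable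
  show thesis
  proof (rule that)
    show "continuous_on UNIV g"
      unfolding g_def by (intro hk_cont G)
    show "integrable lborel g"
    proof (rule Bochner_Integration.integrable_bound)
      show "integrable lborel (\<lambda>x. ?M k * \<eta> k x)"
        by (intro integrable_mult_right \<eta>_int)
    qed (use h2 \<eta> in \<open>auto simp: g_def abs_mult\<close>)
    have "integrable lborel (\<lambda>x. (?M k)\<^sup>2 * \<eta> k x)"
      by (intro integrable_mult_right \<eta>_int)
    then have "integrable lborel (\<lambda>x. (norm (g x))\<^sup>2)"
      by (rule Bochner_Integration.integrable_bound) (use h2' \<eta> in \<open>auto simp: g_def abs_mult\<close>)
    then show "sq_norm g < \<infinity>"
      unfolding sq_norm_lborel by (simp add: nn_integral_eq_integral)
    have "sq_norm (\<lambda>x. f x - g x) \<le> 2 * sq_norm (\<lambda>x. f x - h k f x) + 2 * sq_norm (\<lambda>x. h k f x - g x)"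
      using sq_norm_add_le[of "\<lambda>x. f x - h k f x" "\<lambda>x. h k f x - g x"]
      by (simp add: measurable_completion)
    also have "\<dots> \<le> 2 * ennreal (e / 4) + 2 * ennreal (e / 4)"
      using k j unfolding g_def[symmetric] by (intro add_mono mult_left_mono) auto
    also have "2 * ennreal (e / 4) = ennreal (e / 2)"
      using ennreal_mult'[of 2 "e / 4"] by simp
    also have "ennreal (e / 2) + ennreal (e / 2) = ennreal e"
      using e by (subst ennreal_plus[symmetric]) auto
    finally show "sq_norm (\<lambda>x. f x - g x) \<le> ennreal e" .
  qed
qed

section \<open>The lower Plancherel inequality without continuity\<close>

lemma one_le_gauss_mass: "1 \<le> gauss_mass TYPE('a::euclidean_space)"
proof -
  have "1 \<le> sqrt (2 * pi)" using pi_gt3 by simp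
  then show ?thesis unfolding gauss_mass_def by (rule one_le_power)
qed

lemma fourier_diff:
  fixes f g :: "'a::euclidean_space \<Rightarrow> complex"
  assumes f: "integrable lborel f" and g: "integrable lborel g"
  shows "fourier (\<lambda>x. f x - g x) \<xi> = fourier f \<xi> - fourier g \<xi>"
proof -
  have "integrable lborel (\<lambda>x. iexp (- (x \<bullet> \<xi>)) * h x)" if "integrable lborel h" for h :: "'a \<Rightarrow> complex"
    using that by (rule Bochner_Integration.integrable_bound) (use that in \<open>auto simp: norm_mult\<close>)
  from this[OF f] this[OF g] show ?thesis
    using f g by (subst (1 2 3) fourier_borel) (auto simp: right_diff_distrib)
qed

text \<open>The lower inequality holds for a continuous \<open>g\<close> close to \<open>f\<close>.
  The transforms of \<open>f\<close> and \<open>g\<close> are close as well, by the upper inequality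
  applied to \<open>g - f\<close>. Passing from \<open>f\<close> to \<open>g\<close> and from the
  transform of \<open>g\<close> to that of \<open>f\<close> costs a factor 2 each.\<close>

lemma sq_norm_le_fourier:
  fixes f :: "'a::euclidean_space \<Rightarrow> complex"
  assumes f: "integrable lborel f" and L2: "sq_norm f < \<infinity>"
  shows "sq_norm f \<le> 4 * sq_norm (fourier f)"
proof (rule ennreal_le_epsilon)
  fix e :: real assume e: "0 < e"
  define c where "c = (gauss_mass TYPE('a))\<^sup>2"
  have c: "1 \<le> c" unfolding c_def by (intro one_le_power one_le_gauss_mass)
  have [measurable]: "f \<in> borel_measurable borel" using f by auto
  \<comment> \<open>Chosen so that the accumulated error \<open>4 * (c * d) + 2 * d\<close> equals
    \<open>e\<close>.\<close>
  define d where "d = e / (4 * c + 2)"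
  have d: "0 < d" using e c by (simp add: d_def)
  obtain g where cont: "continuous_on UNIV g" and g: "integrable lborel g" and g2: "sq_norm g < \<infinity>"
    and fg: "sq_norm (\<lambda>x. f x - g x) \<le> ennreal d"
    using continuous_approximation_sq_norm[of f d] L2 d by auto
  have [measurable]: "g \<in> borel_measurable borel" using g by auto
  have leb [measurable]: "h \<in> borel_measurable lebesgue" if "h \<in> borel_measurable borel" for h :: "'a \<Rightarrow> complex"
    using that by (simp add: measurable_completion)
  have gf: "sq_norm (\<lambda>x. g x - f x) = sq_norm (\<lambda>x. f x - g x)"
    unfolding sq_norm_def by (simp add: norm_minus_commute)
  have fin: "sq_norm (\<lambda>x. g x - f x) < \<infinity>"
    using le_less_trans[OF fg] unfolding gf by simp
  have "sq_norm (\<lambda>\<xi>. fourier g \<xi> - fourier f \<xi>) = sq_norm (fourier (\<lambda>x. g x - f x))"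
    using fourier_diff[OF g f] by (intro arg_cong[of _ _ sq_norm] ext) simp
  also have "\<dots> \<le> ennreal c * sq_norm (\<lambda>x. f x - g x)"
    unfolding gf[symmetric] c_def
    by (rule sq_norm_fourier_le[OF Bochner_Integration.integrable_diff[OF g f] fin])
  also have "\<dots> \<le> ennreal c * ennreal d"
    using fg by (intro mult_left_mono) auto
  finally have diff: "sq_norm (\<lambda>\<xi>. fourier g \<xi> - fourier f \<xi>) \<le> ennreal c * ennreal d" .
  \<comment> \<open>Lowering the factor \<open>c\<close> to 1 gives up sharpness and leaves a
    constant without reference to the dimension.\<close>
  have "sq_norm g = 1 * sq_norm g"
    by simp
  also have "\<dots> \<le> ennreal c * sq_norm g"
    using c by (intro mult_right_mono) auto
  also have "\<dots> \<le> sq_norm (fourier g)"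
    unfolding c_def by (rule sq_norm_le_fourier_continuous[OF g g2 cont])
  also have "\<dots> \<le> 2 * sq_norm (fourier f) + 2 * sq_norm (\<lambda>\<xi>. fourier g \<xi> - fourier f \<xi>)"
    using sq_norm_add_le[of "fourier f" "\<lambda>\<xi>. fourier g \<xi> - fourier f \<xi>"] by (simp add: leb)
  also have "\<dots> \<le> 2 * sq_norm (fourier f) + 2 * (ennreal c * ennreal d)"
    by (intro add_left_mono mult_left_mono diff) simp
  finally have gbound: "sq_norm g \<le> 2 * sq_norm (fourier f) + 2 * (ennreal c * ennreal d)" .
  have arith: "2 * (2 * x + 2 * y) + 2 * z = 4 * x + (4 * y + 2 * z)" for x y z :: ennreal
    by (simp add: distrib_left mult.assoc[symmetric] add.assoc)
  have "sq_norm f \<le> 2 * sq_norm g + 2 * sq_norm (\<lambda>x. f x - g x)"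
    using sq_norm_add_le[of g "\<lambda>x. f x - g x"] by (simp add: leb)
  also have "\<dots> \<le> 2 * (2 * sq_norm (fourier f) + 2 * (ennreal c * ennreal d)) + 2 * ennreal d"
    by (intro add_mono mult_left_mono gbound fg) auto
  also have "\<dots> = 4 * sq_norm (fourier f) + (4 * (ennreal c * ennreal d) + 2 * ennreal d)"
    by (rule arith)
  also have "4 * (ennreal c * ennreal d) + 2 * ennreal d = ennreal (4 * (c * d) + 2 * d)"
    using c d by (subst ennreal_plus) (auto simp: ennreal_mult')
  also have "4 * (c * d) + 2 * d = e"
  proof -
    have "4 * (c * d) + 2 * d = (4 * c + 2) * d" by (simp add: algebra_simps)
    then show ?thesis using c by (simp add: d_def)
  qed
  finally show "sq_norm f \<le> 4 * sq_norm (fourier f) + ennreal e" .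
qed

section \<open>From Borel to Lebesgue measurable functions\<close>

lemma lebesgue_measurable_borel_representative:
  fixes f :: "'a::euclidean_space \<Rightarrow> complex"
  assumes [measurable]: "f \<in> borel_measurable lebesgue"
  obtains f' where "f' \<in> borel_measurable borel" "AE x in lebesgue. f x = f' x"
proof -
  have "(\<lambda>x. Re (f x)) \<in> borel_measurable lebesgue" "(\<lambda>x. Im (f x)) \<in> borel_measurable lebesgue"
    by measurable
  from this[THEN completion_ex_borel_measurable_real] obtain r i where
    [measurable]: "r \<in> borel_measurable lborel" "i \<in> borel_measurable lborel"
    and r: "AE x in lborel. Re (f x) = r x" and i: "AE x in lborel. Im (f x) = i x"
    by auto
  show thesis
  proof (rule that)
    have "(\<lambda>x. Complex (r x) (i x)) \<in> borel_measurable lborel"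
      unfolding borel_measurable_complex_iff by simp
    then show "(\<lambda>x. Complex (r x) (i x)) \<in> borel_measurable borel" by simp
    show "AE x in lebesgue. f x = Complex (r x) (i x)"
      unfolding AE_completion_iff using r i by eventually_elim (simp add: complex_eq_iff)
  qed
qed

text \<open>The transform and the squared norm are integrals, so they are unchanged when
  \<open>f\<close> is replaced by an almost everywhere equal Borel function, to which the results
  over \<open>lborel\<close> apply.\<close>

lemma borel_representative:
  fixes f :: "'a::euclidean_space \<Rightarrow> complex"
  assumes f: "f \<in> L1_space"
  obtains f' where "integrable lborel f'" "fourier f = fourier f'" "sq_norm f = sq_norm f'"
proof -
  have int: "integrable lebesgue f" using f by (simp add: L1_space_def)
  then have [measurable]: "f \<in> borel_measurable lebesgue" by auto
  obtain f' where f' [measurable]: "f' \<in> borel_measurable borel" and ae: "AE x in lebesgue. f x = f' x"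
    using lebesgue_measurable_borel_representative[of f] by auto
  have [measurable]: "f' \<in> borel_measurable lebesgue"
    using f' by (simp add: measurable_completion)
  show thesis
  proof (rule that)
    have "integrable lebesgue f'"
      using int ae by (subst (asm) integrable_cong_AE) auto
    then show "integrable lborel f'"
      using f' by (subst (asm) integrable_completion) auto
    show "fourier f = fourier f'"
    proof
      fix \<xi>
      show "fourier f \<xi> = fourier f' \<xi>"
        unfolding fourier_def
      proof (rule integral_cong_AE)
        have [measurable]: "(\<lambda>x. exp (- \<i> * complex_of_real (x \<bullet> \<xi>))) \<in> borel_measurable lebesgue"
          by (intro measurable_completion) simp
        show "(\<lambda>x. exp (- \<i> * complex_of_real (x \<bullet> \<xi>)) * f x) \<in> borel_measurable lebesgue"
          "(\<lambda>x. exp (- \<i> * complex_of_real (x \<bullet> \<xi>)) * f' x) \<in> borel_measurable lebesgue"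
          by measurable
      qed (use ae in eventually_elim, simp)
    qed
    show "sq_norm f = sq_norm f'"
      unfolding sq_norm_def using ae by (intro nn_integral_cong_AE) auto
  qed
qed

lemma
  fixes f :: "'a::euclidean_space \<Rightarrow> complex"
  assumes f: "f \<in> L1_space" and L2: "sq_norm f < \<infinity>"
  shows sq_norm_fourier_le_L1: "sq_norm (fourier f) \<le> ennreal ((gauss_mass TYPE('a))\<^sup>2) * sq_norm f"
    and sq_norm_le_fourier_L1: "sq_norm f \<le> 4 * sq_norm (fourier f)"
    and borel_measurable_fourier_L1: "fourier f \<in> borel_measurable borel"
proof -
  obtain f' where f': "integrable lborel f'" and eq: "fourier f = fourier f'" "sq_norm f = sq_norm f'"
    using borel_representative[OF f] .
  have fin: "sq_norm f' < \<infinity>"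
    using L2 eq by simp
  show "sq_norm (fourier f) \<le> ennreal ((gauss_mass TYPE('a))\<^sup>2) * sq_norm f"
    unfolding eq by (rule sq_norm_fourier_le[OF f' fin])
  show "sq_norm f \<le> 4 * sq_norm (fourier f)"
    unfolding eq by (rule sq_norm_le_fourier[OF f' fin])
  have [measurable]: "f' \<in> borel_measurable borel" using f' by auto
  show "fourier f \<in> borel_measurable borel"
    unfolding eq by measurable
qed

section \<open>The lower inequality for the Fourier-Plancherel transform\<close>

lemma sq_norm_L2_space:
  assumes "f \<in> L2_space"
  shows "sq_norm f = ennreal ((L2_norm f)\<^sup>2)"
  using assms unfolding L2_space_def sq_norm_def L2_norm_def
  by (simp add: nn_integral_eq_integral)

text \<open>A ball has finite measure, and \<open>|f| <= 1 + |f|^2\<close> there.\<close>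

lemma L2_space_indicator_in_L1_space:
  fixes f :: "'a::euclidean_space \<Rightarrow> complex"
  assumes f: "f \<in> L2_space"
  shows "(\<lambda>x. indicator (cball 0 R) x * f x) \<in> L1_space"
proof -
  have [measurable]: "f \<in> borel_measurable lebesgue" and f2: "integrable lebesgue (\<lambda>x. (norm (f x))\<^sup>2)"
    using f by (auto simp: L2_space_def)
  have [measurable]: "cball 0 R \<in> sets (lebesgue :: 'a measure)"
    by simp
  have "integrable lebesgue (\<lambda>x. indicator (cball 0 R) x + (norm (f x))\<^sup>2)"
    using f2 emeasure_compact_finite[OF compact_cball, of "0::'a" R]
    by (intro Bochner_Integration.integrable_add) auto
  then have "integrable lebesgue (\<lambda>x. indicator (cball 0 R) x * f x)"
  proof (rule Bochner_Integration.integrable_bound)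
    show "AE x in lebesgue. norm (indicator (cball 0 R) x * f x) \<le> norm (indicator (cball 0 R) x + (norm (f x))\<^sup>2)"
    proof (intro AE_I2)
      fix x
      have "2 * norm (f x) \<le> 1 + (norm (f x))\<^sup>2"
        using zero_le_power2[of "norm (f x) - 1"] by (simp add: power2_eq_square algebra_simps)
      then have "norm (f x) \<le> 1 + (norm (f x))\<^sup>2"
        using norm_ge_zero[of "f x"] by linarith
      then show "norm (indicator (cball 0 R) x * f x) \<le> norm (indicator (cball 0 R) x + (norm (f x))\<^sup>2)"
        by (auto simp: indicator_def)
    qed
  qed measurable
  then show ?thesis by (simp add: L1_space_def)
qed

text \<open>The cut-offs \<open>h k\<close> to balls of integer radius lie in L1 and L2, so the
  lower inequality with constant 4 applies to them. Replacing their transforms by the limit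
  \<open>g\<close> costs another factor 2, and Fatou's lemma recovers \<open>f\<close> from its
  cut-offs.\<close>

lemma sq_norm_le_fourier_plancherel:
  fixes f :: "'a::euclidean_space \<Rightarrow> complex"
  assumes "fourier_plancherel f g"
  shows "sq_norm f \<le> 8 * sq_norm g"
proof -
  have f: "f \<in> L2_space" and g: "g \<in> L2_space"
    and lim: "((\<lambda>R. sq_norm (\<lambda>\<xi>. fourier (\<lambda>x. indicator (cball 0 R) x * f x) \<xi> - g \<xi>)) \<longlongrightarrow> 0) at_top"
    using assms unfolding fourier_plancherel_def sq_norm_def by auto
  have [measurable]: "f \<in> borel_measurable lebesgue" "g \<in> borel_measurable lebesgue"
    using f g by (auto simp: L2_space_def)
  define h where "h k x = indicator (cball 0 (real k)) x * f x" for k :: nat and x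
  have h1: "h k \<in> L1_space" for k
    unfolding h_def[abs_def] using f by (rule L2_space_indicator_in_L1_space)
  have h_le: "sq_norm (h k) \<le> sq_norm f" for k
    unfolding sq_norm_def h_def by (intro nn_integral_mono) (auto simp: indicator_def)
  have fin: "sq_norm f < \<infinity>"
    using sq_norm_L2_space[OF f] by simp
  have h2: "sq_norm (h k) < \<infinity>" for k
    using h_le fin by (rule le_less_trans)
  have lim_h: "(\<lambda>k. sq_norm (\<lambda>\<xi>. fourier (h k) \<xi> - g \<xi>)) \<longlonglongrightarrow> 0"
    unfolding h_def[abs_def] by (rule filterlim_compose[OF lim filterlim_real_sequentially])
  have [measurable]: "h k \<in> borel_measurable lebesgue" for k
    using h1[of k] by (auto simp: L1_space_def)
  have [measurable]: "fourier (h k) \<in> borel_measurable lebesgue" for k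
    using borel_measurable_fourier_L1[OF h1 h2] by (simp add: measurable_completion)
  show ?thesis
  proof (rule ennreal_le_epsilon)
    fix e :: real assume e: "0 < e"
    have "sq_norm f = (\<integral>\<^sup>+x. liminf (\<lambda>k. ennreal ((norm (h k x))\<^sup>2)) \<partial>lebesgue)"
      unfolding sq_norm_def
    proof (intro nn_integral_cong lim_imp_Liminf[symmetric] tendsto_eventually)
      fix x :: 'a
      obtain N where N: "norm x \<le> real N" using real_arch_simple by blast
      show "eventually (\<lambda>k. ennreal ((norm (h k x))\<^sup>2) = ennreal ((norm (f x))\<^sup>2)) sequentially"
        unfolding eventually_sequentially
        by (intro exI[of _ N]) (use N in \<open>auto simp: h_def indicator_def\<close>)
    qed simp
    also have "\<dots> \<le> liminf (\<lambda>k. sq_norm (h k))"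
      unfolding sq_norm_def by (rule nn_integral_liminf) measurable
    also have "\<dots> \<le> 8 * sq_norm g + ennreal e"
    proof (rule Liminf_le)
      have "eventually (\<lambda>k. sq_norm (\<lambda>\<xi>. fourier (h k) \<xi> - g \<xi>) < ennreal (e / 8)) sequentially"
        using e by (intro order_tendstoD(2)[OF lim_h]) simp
      then show "eventually (\<lambda>k. sq_norm (h k) \<le> 8 * sq_norm g + ennreal e) sequentially"
      proof eventually_elim
        case (elim k)
        have arith: "4 * (2 * x + 2 * y) = 8 * x + 8 * y" for x y :: ennreal
          by (simp add: distrib_left mult.assoc[symmetric])
        have "sq_norm (fourier (h k)) \<le> 2 * sq_norm g + 2 * sq_norm (\<lambda>\<xi>. fourier (h k) \<xi> - g \<xi>)"
          using sq_norm_add_le[of g "\<lambda>\<xi>. fourier (h k) \<xi> - g \<xi>"] by simp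
        also have "\<dots> \<le> 2 * sq_norm g + 2 * ennreal (e / 8)"
          using elim by (intro add_left_mono mult_left_mono) auto
        finally have le: "sq_norm (fourier (h k)) \<le> 2 * sq_norm g + 2 * ennreal (e / 8)" .
        have "sq_norm (h k) \<le> 4 * sq_norm (fourier (h k))"
          by (rule sq_norm_le_fourier_L1[OF h1 h2])
        also have "\<dots> \<le> 4 * (2 * sq_norm g + 2 * ennreal (e / 8))"
          by (intro mult_left_mono le) simp
        also have "\<dots> = 8 * sq_norm g + 8 * ennreal (e / 8)"
          by (rule arith)
        also have "8 * ennreal (e / 8) = ennreal e"
          using e ennreal_mult'[of 8 "e / 8"] by simp
        finally show ?case .
      qed
    qed simp
    finally show "sq_norm f \<le> 8 * sq_norm g + ennreal e" .
  qed
qed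

section \<open>The singular Gaussian integral\<close>

lemma exp_div_eq_nn_integral:
  fixes b t :: real
  assumes "0 < b"
  shows "(\<integral>\<^sup>+s. ennreal (exp (- (b * s))) * indicator {t..} s \<partial>lborel) = ennreal (exp (- (b * t)) / b)"
proof -
  have "(\<integral>\<^sup>+s. ennreal (exp (- (b * s))) * indicator {t..} s \<partial>lborel) = ennreal (0 - (- (exp (- (b * t)) / b)))"
  proof (rule nn_integral_FTC_atLeast)
    show "((\<lambda>s. - (exp (- (b * s)) / b)) has_real_derivative exp (- (b * s))) (at s)" for s
      using assms by (auto intro!: derivative_eq_intros)
    have "((\<lambda>s. - (exp (- (b * s)) / b)) \<longlongrightarrow> - (0 / b)) at_top"
    proof (intro tendsto_intros)
      show "((\<lambda>s. exp (- (b * s))) \<longlongrightarrow> 0) at_top"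
        using assms by real_asymp
    qed (use assms in auto)
    then show "((\<lambda>s. - (exp (- (b * s)) / b)) \<longlongrightarrow> 0) at_top" by simp
  qed auto
  then show ?thesis by simp
qed

text \<open>
  Writing \<open>exp (- t |x|\<^sup>2 / 4) / |x|\<^sup>2\<close> as the integral of \<open>exp (- s |x|\<^sup>2)\<close> over \<open>s \<ge> t / 4\<close> reduces the
  singular integral to the Gaussian one. At \<open>x = 0\<close> the integrand has the junk value 0.
\<close>

lemma nn_integral_singular_gaussian_le:
  fixes t :: real
  assumes dim: "2 < DIM('a::euclidean_space)" and t: "0 < t"
  shows "(\<integral>\<^sup>+x. ennreal (exp (- (t * (norm (x::'a))\<^sup>2 / 4)) / (norm x)\<^sup>2) \<partial>lborel)
    \<le> ennreal (gauss_mass TYPE('a) / (real DIM('a) - 2) * (t / 2) powr (- ((real DIM('a) - 2) / 2)))"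
proof -
  let ?n = "real DIM('a)" and ?Z = "gauss_mass TYPE('a)"
  let ?k = "\<lambda>(x::'a) s. ennreal (exp (- ((norm x)\<^sup>2 * s))) * indicator {t/4..} s"
  have "(\<integral>\<^sup>+x. ennreal (exp (- (t * (norm (x::'a))\<^sup>2 / 4)) / (norm x)\<^sup>2) \<partial>lborel)
      \<le> (\<integral>\<^sup>+x. \<integral>\<^sup>+s. ?k x s \<partial>lborel \<partial>lborel)"
  proof (intro nn_integral_mono)
    fix x :: 'a
    show "ennreal (exp (- (t * (norm x)\<^sup>2 / 4)) / (norm x)\<^sup>2) \<le> (\<integral>\<^sup>+s. ?k x s \<partial>lborel)"
      using exp_div_eq_nn_integral[of "(norm x)\<^sup>2" "t/4"]
      by (cases "x = 0") (auto simp: mult.commute)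
  qed
  also have "\<dots> = (\<integral>\<^sup>+s. \<integral>\<^sup>+x. ?k x s \<partial>lborel \<partial>lborel)"
    by (rule lborel_pair.Fubini'[symmetric]) measurable
  also have "\<dots> = (\<integral>\<^sup>+s. ennreal (?Z * (2 * s) powr (- (?n / 2))) * indicator {t/4..} s \<partial>lborel)"
  proof (intro nn_integral_cong)
    fix s :: real
    show "(\<integral>\<^sup>+x. ?k x s \<partial>lborel) = ennreal (?Z * (2 * s) powr (- (?n / 2))) * indicator {t/4..} s"
    proof (cases "s \<in> {t/4..}")
      case True
      with t have s: "0 < s" by auto
      have eq: "(norm x)\<^sup>2 * s = (sqrt (2 * s) * norm x)\<^sup>2 / 2" for x :: 'a
        using s by (simp add: power_mult_distrib)
      have "sqrt (2 * s) ^ DIM('a) = (2 * s) powr (?n / 2)"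
        using s by (simp add: powr_half_sqrt[symmetric] powr_powr powr_realpow[symmetric])
      then have "(LINT x|lborel. exp (- ((norm (x::'a))\<^sup>2 * s))) = ?Z * (2 * s) powr (- (?n / 2))"
        using integral_gaussian[of "sqrt (2 * s)", where 'a='a] s
        by (simp add: eq powr_minus_divide)
      moreover have "integrable lborel (\<lambda>x::'a. exp (- ((norm x)\<^sup>2 * s)))"
        using integrable_gaussian[of "sqrt (2 * s)", where 'a='a] s by (simp add: eq)
      ultimately show ?thesis
        using True by (simp add: nn_integral_eq_integral)
    qed simp
  qed
  \<comment> \<open>The antiderivative has exponent \<open>1 - n / 2\<close>, which is negative
    because \<open>n > 2\<close>, so it vanishes at infinity and only the endpoint
    \<open>s = t / 4\<close> contributes.\<close>
  also have "\<dots> = ennreal (0 - (- (?Z / (?n - 2) * (2 * (t / 4)) powr (1 - ?n / 2))))"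
  proof (rule nn_integral_FTC_atLeast)
    fix s assume "t / 4 \<le> s"
    with t have s: "0 < s" by auto
    have "((\<lambda>s. - (?Z / (?n - 2) * (2 * s) powr (1 - ?n / 2))) has_real_derivative
        - (?Z / (?n - 2) * ((1 - ?n / 2) * (2 * s) powr (1 - ?n / 2 - 1) * 2))) (at s)"
    proof (intro DERIV_minus DERIV_cmult)
      show "((\<lambda>s. (2 * s) powr (1 - ?n / 2)) has_real_derivative
          (1 - ?n / 2) * (2 * s) powr (1 - ?n / 2 - 1) * 2) (at s)"
        using s by (intro DERIV_chain2[OF has_real_derivative_powr]) (auto intro!: derivative_eq_intros)
    qed
    moreover have "- (?Z / (?n - 2) * ((1 - ?n / 2) * (2 * s) powr (1 - ?n / 2 - 1) * 2))
        = ?Z * (2 * s) powr (- (?n / 2))"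
      using dim by (simp add: field_simps)
    ultimately show "((\<lambda>s. - (?Z / (?n - 2) * (2 * s) powr (1 - ?n / 2))) has_real_derivative
        ?Z * (2 * s) powr (- (?n / 2))) (at s)" by simp
    show "0 \<le> ?Z * (2 * s) powr (- (?n / 2))"
      using gauss_mass_pos[where 'a='a] by simp
  next
    have "((\<lambda>s. (2 * s) powr (1 - ?n / 2)) \<longlongrightarrow> 0) at_top"
      using dim by (intro tendsto_neg_powr filterlim_tendsto_pos_mult_at_top[OF tendsto_const])
        (auto simp: filterlim_ident)
    then have "((\<lambda>s. - (?Z / (?n - 2) * (2 * s) powr (1 - ?n / 2))) \<longlongrightarrow> - (?Z / (?n - 2) * 0)) at_top"
      by (intro tendsto_intros)
    then show "((\<lambda>s. - (?Z / (?n - 2) * (2 * s) powr (1 - ?n / 2))) \<longlongrightarrow> 0) at_top"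
      by simp
  qed auto
  also have "1 - ?n / 2 = - ((?n - 2) / 2)"
    by (simp add: field_simps)
  finally show ?thesis by simp
qed

section \<open>Decay of a single mode\<close>

lemma norm_sq_has_real_derivative:
  fixes y :: "real \<Rightarrow> complex"
  assumes "(y has_vector_derivative y') (at t)"
  shows "((\<lambda>t. (norm (y t))\<^sup>2) has_real_derivative 2 * (y t \<bullet> y')) (at t)"
  using assms unfolding power2_norm_eq_inner has_vector_derivative_def has_field_derivative_def
  by (auto intro!: derivative_eq_intros simp: inner_commute algebra_simps)

lemma inner_has_real_derivative:
  fixes y z :: "real \<Rightarrow> complex"
  assumes "(y has_vector_derivative y') (at t)" "(z has_vector_derivative z') (at t)"
  shows "((\<lambda>t. y t \<bullet> z t) has_real_derivative y t \<bullet> z' + y' \<bullet> z t) (at t)"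
  using assms unfolding has_vector_derivative_def has_field_derivative_def
  by (auto intro!: derivative_eq_intros simp: algebra_simps)

text \<open>
  The cross term \<open>y \<bullet> y'\<close> in the Lyapunov function supplies the missing decay of \<open>|y|\<^sup>2\<close>; its weight
  \<open>min a 1 / 2\<close> keeps the function comparable with the energy \<open>|y'|\<^sup>2 + a |y|\<^sup>2\<close> both for small and
  for large \<open>a\<close>.
\<close>

lemma solves_mode_decay:
  fixes a :: real
  assumes sol: "solves_mode a c\<^sub>0 c\<^sub>1 y" and a: "0 < a" and t: "0 \<le> t"
  shows "(norm (y t))\<^sup>2 \<le> 4 * exp (- (min a 1 / 2 * t)) * ((norm c\<^sub>0)\<^sup>2 + (norm c\<^sub>1)\<^sup>2 / a)"
proof -
  define e where "e = min a 1 / 2"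
  \<comment> \<open>Each bound has its task: \<open>4 * e\<^sup>2 \<le> a\<close> absorbs the cross
    term into the energy, \<open>e \<le> 1/2\<close> the additional \<open>a |y|^2\<close>, and
    \<open>e \<le> a / 2\<close> leaves enough damping of \<open>y'\<close>.\<close>
  have e: "0 < e" "e \<le> a / 2" "4 * e\<^sup>2 \<le> a" "e \<le> 1/2"
  proof -
    have "(min a 1)\<^sup>2 \<le> a"
      using a mult_mono[of "min a 1" a "min a 1" 1] by (simp add: power2_eq_square)
    then show "4 * e\<^sup>2 \<le> a" by (simp add: e_def power2_eq_square)
  qed (use a in \<open>auto simp: e_def\<close>)
  obtain y' y'' where
    d0: "\<And>t. 0 \<le> t \<Longrightarrow> (y has_vector_derivative y' t) (at t within {0..})"
    and d1: "\<And>t. 0 < t \<Longrightarrow> (y' has_vector_derivative y'' t) (at t)"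
    and ode: "\<And>t. 0 < t \<Longrightarrow> y'' t + a *\<^sub>R y t + a *\<^sub>R y' t = 0"
    and init: "y 0 = c\<^sub>0" "y' 0 = c\<^sub>1"
    using sol unfolding solves_mode_def by blast
  have cont_y: "continuous_on {0..} y"
    using d0 by (intro continuous_on_vector_derivative) auto
  have dy: "(y has_vector_derivative y' t) (at t)" if "0 < t" for t
    using d0[of t] that by (simp add: at_within_interior[of t "{0..}"])
  \<comment> \<open>\<open>solves_mode\<close> differentiates \<open>y'\<close> only at positive
    times, so the link between \<open>y' t\<close> and the datum \<open>y' 0\<close> has to be
    proved. Integrating the equation shows that \<open>y'\<close> agrees on \<open>(0, 1]\<close>
    with a function \<open>p\<close> continuous on \<open>[0, 1]\<close>; then \<open>y\<close> is
    an integral of \<open>p\<close>, its one-sided derivative at 0 is \<open>p 0\<close>, and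
    uniqueness of derivatives gives \<open>y' 0 = p 0\<close>.\<close>
  have cont_y': "(y' \<longlongrightarrow> y' 0) (at_right 0)"
  proof -
    \<comment> \<open>Obtained by integrating \<open>(y' + a y)' = - a y\<close> from
      \<open>t\<close> to 1 and solving for \<open>y' t\<close>.\<close>
    define p where "p t = y' 1 + a *\<^sub>R y 1 + a *\<^sub>R integral {t..1} y - a *\<^sub>R y t" for t
    have y1: "continuous_on {0..1} y"
      using cont_y by (rule continuous_on_subset) auto
    have cont_p: "continuous_on {0..1} p"
      unfolding p_def
      by (intro continuous_intros y1 indefinite_integral_continuous_1' integrable_continuous_real)
    have p: "y' t = p t" if "0 < t" "t \<le> 1" for t
    proof -
      have "((\<lambda>s. - (a *\<^sub>R y s)) has_integral (y' 1 + a *\<^sub>R y 1 - (y' t + a *\<^sub>R y t))) {t..1}"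
      proof (rule fundamental_theorem_of_calculus[OF \<open>t \<le> 1\<close>])
        fix s assume "s \<in> {t..1}"
        then have s: "0 < s" using that by auto
        have "((\<lambda>s. y' s + a *\<^sub>R y s) has_vector_derivative y'' s + a *\<^sub>R y' s) (at s)"
          by (intro has_vector_derivative_add d1 dy s
              bounded_linear.has_vector_derivative[OF bounded_linear_scaleR_right])
        moreover have "y'' s + a *\<^sub>R y' s = - (a *\<^sub>R y s)"
          using ode[OF s] by (simp add: algebra_simps eq_neg_iff_add_eq_0)
        ultimately show "((\<lambda>s. y' s + a *\<^sub>R y s) has_vector_derivative - (a *\<^sub>R y s)) (at s within {t..1})"
          by (simp add: has_vector_derivative_at_within)
      qed
      then have "integral {t..1} (\<lambda>s. - (a *\<^sub>R y s)) = y' 1 + a *\<^sub>R y 1 - (y' t + a *\<^sub>R y t)"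
        by (rule integral_unique)
      then show ?thesis
        by (simp add: p_def algebra_simps)
    qed
    have yp: "y t = y 0 + integral {0..t} p" if "t \<in> {0..1}" for t
    proof -
      have "(p has_integral (y t - y 0)) {0..t}"
      proof (rule fundamental_theorem_of_calculus_interior)
        show "continuous_on {0..t} y"
          using y1 by (rule continuous_on_subset) (use that in auto)
        show "(y has_vector_derivative p s) (at s)" if "s \<in> {0<..<t}" for s
          using that dy[of s] p[of s] \<open>t \<in> {0..1}\<close> by auto
      qed (use that in auto)
      then show ?thesis by (simp add: integral_unique)
    qed
    have "((\<lambda>t. y 0 + integral {0..t} p) has_vector_derivative p 0) (at 0 within {0..1})"
      using has_vector_derivative_add[OF has_vector_derivative_const integral_has_vector_derivative[OF cont_p, of 0]]
      by simp
    then have "(y has_vector_derivative p 0) (at 0 within {0..1})"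
      by (rule has_vector_derivative_transform[of 0 "{0..1}", rotated 2]) (simp, rule yp)
    moreover have "(y has_vector_derivative y' 0) (at 0 within {0..1})"
      using d0[of 0] by (rule has_vector_derivative_within_subset) auto
    ultimately have p0: "y' 0 = p 0"
      by (intro vector_derivative_unique_within[of 0 "{0..1}"]) (auto simp: trivial_limit_within islimpt_Icc)
    have "(p \<longlongrightarrow> p 0) (at 0 within {0..1})"
      using cont_p by (auto simp: continuous_on_def)
    then have "(p \<longlongrightarrow> p 0) (at_right 0)"
      by (simp add: at_within_Icc_at_right)
    moreover have "eventually (\<lambda>t. p t = y' t) (at_right 0)"
      unfolding eventually_at_right_field using p by (intro exI[of _ 1]) auto
    ultimately show ?thesis
      unfolding p0 by (rule Lim_transform_eventually)
  qed
  have lim_y: "(y \<longlongrightarrow> y 0) (at_right 0)"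
    using cont_y unfolding continuous_on_def at_within_Ici_at_right[symmetric]  by auto
  \<comment> \<open>The term \<open>a |y|^2\<close> next to the cross term is there for its
    derivative \<open>2 a (y \<bullet> y')\<close>, which cancels the contribution of the damping to
    the derivative of \<open>2 (y \<bullet> y')\<close>; \<open>F_deriv\<close> is then free of
    mixed terms.\<close>
  define F where "F t = (norm (y' t))\<^sup>2 + a * (norm (y t))\<^sup>2 + e * (2 * (y t \<bullet> y' t) + a * (norm (y t))\<^sup>2)" for t
  have cross: "2 * e * \<bar>y t \<bullet> y' t\<bar> \<le> (norm (y' t))\<^sup>2 / 2 + a * (norm (y t))\<^sup>2 / 2" for t
  proof -
    have "2 * e * \<bar>y t \<bullet> y' t\<bar> \<le> 2 * e * (norm (y t) * norm (y' t))"
      using e Cauchy_Schwarz_ineq2[of "y t" "y' t"] by (intro mult_left_mono) auto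
    also have "\<dots> \<le> (norm (y' t))\<^sup>2 / 2 + 2 * e\<^sup>2 * (norm (y t))\<^sup>2"
      using zero_le_power2[of "norm (y' t) - 2 * e * norm (y t)"]
      by (simp add: power2_eq_square algebra_simps)
    also have "2 * e\<^sup>2 * (norm (y t))\<^sup>2 \<le> a / 2 * (norm (y t))\<^sup>2"
      using e by (intro mult_right_mono) auto
    finally show ?thesis by simp
  qed
  have cross': "\<bar>e * (2 * (y t \<bullet> y' t))\<bar> \<le> (norm (y' t))\<^sup>2 / 2 + a * (norm (y t))\<^sup>2 / 2" for t
    using cross[of t] e by (simp add: abs_mult mult_ac)
  have e_small: "e * (a * (norm (y t))\<^sup>2) \<le> 1 / 2 * (a * (norm (y t))\<^sup>2)" "0 \<le> e * (a * (norm (y t))\<^sup>2)" for t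
    using e a by (intro mult_right_mono mult_nonneg_nonneg; simp)+
  have F_lower: "a * (norm (y t))\<^sup>2 \<le> 2 * F t" for t
    using cross'[of t] e_small[of t] zero_le_power2[of "norm (y' t)"]
    unfolding F_def distrib_left abs_le_iff by linarith
  have F_upper: "F t \<le> 2 * ((norm (y' t))\<^sup>2 + a * (norm (y t))\<^sup>2)" for t
    using cross'[of t] e_small[of t] zero_le_power2[of "norm (y' t)"]
    unfolding F_def distrib_left abs_le_iff by linarith
  have F_deriv: "(F has_real_derivative
      - 2 * (a - e) * (norm (y' t))\<^sup>2 - 2 * e * (a * (norm (y t))\<^sup>2)) (at t)" if "0 < t" for t
  proof -
    have y'': "y'' t = - a *\<^sub>R y t - a *\<^sub>R y' t"
      using ode[OF that] by (simp add: algebra_simps eq_neg_iff_add_eq_0)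
    have "(F has_real_derivative
        2 * (y' t \<bullet> y'' t) + a * (2 * (y t \<bullet> y' t))
        + e * (2 * (y t \<bullet> y'' t + y' t \<bullet> y' t) + a * (2 * (y t \<bullet> y' t)))) (at t)"
      unfolding F_def using that
      by (intro DERIV_add DERIV_cmult norm_sq_has_real_derivative inner_has_real_derivative d1 dy)
    then show ?thesis
      unfolding y'' by (simp add: power2_norm_eq_inner inner_diff_right inner_minus_right inner_commute algebra_simps)
  qed
  \<comment> \<open>The derivative of \<open>F\<close> is at most \<open>- e * F\<close>, so this
    product is nonincreasing at positive times.\<close>
  define G where "G t = exp (e * t) * F t" for t
  have G_le: "G t \<le> G s" if "0 < s" "s \<le> t" for s t
  proof (rule DERIV_nonpos_imp_nonincreasing[OF \<open>s \<le> t\<close>])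
    fix r assume "s \<le> r" "r \<le> t"
    with that have r: "0 < r" by simp
    let ?D = "- 2 * (a - e) * (norm (y' r))\<^sup>2 - 2 * e * (a * (norm (y r))\<^sup>2)"
    have "(G has_real_derivative exp (e * r) * e * F r + ?D * exp (e * r)) (at r)"
      unfolding G_def by (intro DERIV_mult F_deriv[OF r]) (auto intro!: derivative_eq_intros)
    moreover have "e * F r + ?D \<le> 0"
    proof -
      have "e * F r \<le> e * (2 * ((norm (y' r))\<^sup>2 + a * (norm (y r))\<^sup>2))"
        using F_upper e by (intro mult_left_mono) auto
      moreover have "e * (norm (y' r))\<^sup>2 \<le> (a - e) * (norm (y' r))\<^sup>2"
        using e by (intro mult_right_mono) auto
      ultimately show ?thesis by (simp add: algebra_simps)
    qed
    then have "exp (e * r) * (e * F r + ?D) \<le> 0"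
      by (intro mult_nonneg_nonpos) auto
    ultimately show "\<exists>z. (G has_real_derivative z) (at r) \<and> z \<le> 0"
      by (intro exI conjI) (auto simp: algebra_simps)
  qed
  \<comment> \<open>Monotonicity is known only for positive times; right continuity of
    \<open>y\<close> and \<open>y'\<close> at 0 carries the comparison to \<open>F 0\<close>, which
    contains the data.\<close>
  have lim_G: "(G \<longlongrightarrow> F 0) (at_right 0)"
  proof -
    have "(G \<longlongrightarrow> exp (e * 0) * F 0) (at_right 0)"
      unfolding G_def F_def by (intro tendsto_intros lim_y cont_y')
    then show ?thesis by simp
  qed
  have G0: "G t \<le> F 0"
  proof (cases "t = 0")
    case False
    with t have "eventually (\<lambda>s. G t \<le> G s) (at_right 0)"
      unfolding eventually_at_right_field using G_le by (intro exI[of _ t]) auto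
    then show ?thesis
      by (intro tendsto_lowerbound[OF lim_G]) auto
  qed (simp add: G_def)
  \<comment> \<open>The constant 4 is the product of the factors 2 in \<open>F_lower\<close> and
    \<open>F_upper\<close>; the final division by \<open>a\<close> creates the low-frequency
    singularity of the \<open>c\<^sub>1\<close> term.\<close>
  have "a * (norm (y t))\<^sup>2 \<le> 2 * (exp (- (e * t)) * G t)"
    using F_lower[of t] by (simp add: G_def exp_minus field_simps)
  also have "\<dots> \<le> 2 * (exp (- (e * t)) * (2 * ((norm c\<^sub>1)\<^sup>2 + a * (norm c\<^sub>0)\<^sup>2)))"
    using order_trans[OF G0 F_upper[of 0]] by (simp add: init)
  finally show ?thesis
    using a unfolding e_def[symmetric] by (simp add: field_simps)
qed

section \<open>The decay estimate\<close>

lemma norm_fourier_le_L1_norm: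
  assumes "f \<in> L1_space"
  shows "norm (fourier f \<xi>) \<le> L1_norm f"
  unfolding fourier_def L1_norm_def
  by (rule order_trans[OF integral_norm_bound]) (simp add: norm_mult)

text \<open>For \<open>|xi| <= 1\<close> the first summand alone suffices, otherwise the second;
  their sum avoids splitting the integral later. \<open>A\<close> and \<open>B\<close> are uniform
  bounds, to be filled with squared L1 norms, because the singular weight calls for bounded data,
  whereas the second summand keeps the pointwise values, which are square integrable.\<close>

lemma mode_bound:
  fixes \<xi> :: "'a::euclidean_space"
  assumes sol: "solves_mode (log_symbol \<xi>) c\<^sub>0 c\<^sub>1 y" and \<xi>: "\<xi> \<noteq> 0" and t: "0 \<le> t"
    and c: "(norm c\<^sub>0)\<^sup>2 \<le> A" "(norm c\<^sub>1)\<^sup>2 \<le> B"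
  shows "(norm (y t))\<^sup>2 \<le> 8 * (A + B) * (exp (- (t * (norm \<xi>)\<^sup>2 / 4)) / (norm \<xi>)\<^sup>2)
    + 8 * exp (- (t / 4)) * ((norm c\<^sub>0)\<^sup>2 + (norm c\<^sub>1)\<^sup>2)" (is "_ \<le> ?low + ?high")
proof -
  define r where "r = (norm \<xi>)\<^sup>2"
  define a where "a = log_symbol \<xi>"
  have r: "0 < r" using \<xi> by (simp add: r_def)
  have a_def': "a = ln (1 + r)" by (simp add: a_def log_symbol_def r_def)
  have a: "0 < a" using r by (simp add: a_def')
  have AB: "0 \<le> A" "0 \<le> B"
    using c order_trans[OF zero_le_power2] by blast+
  have low: "0 \<le> ?low" and high: "0 \<le> ?high"
    using AB by auto
  have bound: "(norm (y t))\<^sup>2 \<le> 4 * exp (- (min a 1 / 2 * t)) * ((norm c\<^sub>0)\<^sup>2 + (norm c\<^sub>1)\<^sup>2 / a)"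
    using sol a t unfolding a_def by (rule solves_mode_decay)
  \<comment> \<open>One bound for both regimes: \<open>r / (1 + r)\<close> is at least
    \<open>r / 2\<close> for \<open>r \<le> 1\<close> and at least \<open>1 / 2\<close> for larger
    \<open>r\<close>. This halves the rate once more, to \<open>r / 4\<close> and
    \<open>1 / 4\<close>.\<close>
  have a_ge: "r / (1 + r) \<le> a"
  proof -
    have "ln (1 / (1 + r)) \<le> 1 / (1 + r) - 1"
      using r by (intro ln_le_minus_one) auto
    then show ?thesis
      using r by (simp add: a_def' ln_div field_simps)
  qed
  show ?thesis
  proof (cases "r \<le> 1")
    case True
    have "r / 2 \<le> r / (1 + r)"
      using r True by (intro divide_left_mono) auto
    from order_trans[OF this a_ge] have ar: "r / 2 \<le> a" .
    have "t * (r / 2) \<le> t * min a 1"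
      using ar True t by (intro mult_left_mono) auto
    then have e: "exp (- (min a 1 / 2 * t)) \<le> exp (- (t * r / 4))"
      by (simp add: mult.commute)
    \<comment> \<open>Deliberately weakened, using \<open>r \<le> 1\<close>, so that both data share
      one singular integral.\<close>
    have c0: "(norm c\<^sub>0)\<^sup>2 \<le> 2 * A / r"
    proof -
      have "A * r \<le> A * 2" using AB True by (intro mult_left_mono) auto
      then have "A \<le> 2 * A / r" using r by (simp add: field_simps)
      with c(1) show ?thesis by simp
    qed
    have c1: "(norm c\<^sub>1)\<^sup>2 / a \<le> 2 * B / r"
    proof -
      have "(norm c\<^sub>1)\<^sup>2 / a \<le> B / (r / 2)"
        using c(2) ar r AB by (intro frac_le) auto
      then show ?thesis by (simp add: mult.commute)
    qed
    have "4 * exp (- (min a 1 / 2 * t)) * ((norm c\<^sub>0)\<^sup>2 + (norm c\<^sub>1)\<^sup>2 / a)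
        \<le> 4 * exp (- (t * r / 4)) * (2 * A / r + 2 * B / r)"
      using e c0 c1 a by (intro mult_mono add_mono) auto
    also have "\<dots> = ?low"
      by (simp add: r_def add_divide_distrib[symmetric])
    finally show ?thesis using bound high by linarith
  next
    case False
    have "1 / 2 \<le> r / (1 + r)"
      using False by (simp add: field_simps)
    from order_trans[OF this a_ge] have a2: "1 / 2 \<le> a" .
    have "t * (1 / 2) \<le> t * min a 1"
      using a2 t by (intro mult_left_mono) auto
    then have e: "exp (- (min a 1 / 2 * t)) \<le> exp (- (t / 4))"
      by (simp add: mult.commute)
    have "(norm c\<^sub>1)\<^sup>2 / a \<le> (norm c\<^sub>1)\<^sup>2 / (1 / 2)"
      using a2 by (intro divide_left_mono) auto
    then have "(norm c\<^sub>1)\<^sup>2 / a \<le> 2 * (norm c\<^sub>1)\<^sup>2" by simp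
    then have "(norm c\<^sub>0)\<^sup>2 + (norm c\<^sub>1)\<^sup>2 / a \<le> 2 * ((norm c\<^sub>0)\<^sup>2 + (norm c\<^sub>1)\<^sup>2)"
      using zero_le_power2[of "norm c\<^sub>0"] unfolding distrib_left by linarith
    then have "4 * exp (- (min a 1 / 2 * t)) * ((norm c\<^sub>0)\<^sup>2 + (norm c\<^sub>1)\<^sup>2 / a)
        \<le> 4 * exp (- (t / 4)) * (2 * ((norm c\<^sub>0)\<^sup>2 + (norm c\<^sub>1)\<^sup>2))"
      using e a by (intro mult_mono) auto
    also have "\<dots> = ?high" by simp
    finally show ?thesis using bound low by linarith
  qed
qed

text \<open>The mode bound is integrated over all frequencies: the first summand by the singular
  Gaussian integral, the second by the upper Plancherel inequality for the data. The factor 64 is 8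
  from \<open>mode_bound\<close> times 8 from \<open>sq_norm_le_fourier_plancherel\<close>.\<close>

lemma log_damped_wave_L2_bound:
  fixes u\<^sub>0 u\<^sub>1 :: "'a::euclidean_space \<Rightarrow> complex"
  assumes dim: "2 < DIM('a)" and u0: "u\<^sub>0 \<in> L2_space \<inter> L1_space" and u1: "u\<^sub>1 \<in> L2_space \<inter> L1_space"
    and sol: "log_damped_wave_solution u\<^sub>0 u\<^sub>1 u" and t: "0 < t"
  defines "Z \<equiv> gauss_mass TYPE('a)"
  shows "(L2_norm (u t))\<^sup>2 \<le>
    64 * (((L1_norm u\<^sub>0)\<^sup>2 + (L1_norm u\<^sub>1)\<^sup>2) * (Z / (real DIM('a) - 2) * (t / 2) powr (- ((real DIM('a) - 2) / 2)))
      + exp (- (t / 4)) * (Z\<^sup>2 * ((L2_norm u\<^sub>0)\<^sup>2 + (L2_norm u\<^sub>1)\<^sup>2)))"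
proof -
  obtain v where v: "\<And>t. 0 \<le> t \<Longrightarrow> fourier_plancherel (u t) (v t)"
    and modes: "AE \<xi> in lebesgue. solves_mode (log_symbol \<xi>) (fourier u\<^sub>0 \<xi>) (fourier u\<^sub>1 \<xi>) (\<lambda>t. v t \<xi>)"
    using sol unfolding log_damped_wave_solution_def by blast
  let ?A = "(L1_norm u\<^sub>0)\<^sup>2" and ?B = "(L1_norm u\<^sub>1)\<^sup>2"
  let ?S = "\<lambda>\<xi>::'a. exp (- (t * (norm \<xi>)\<^sup>2 / 4)) / (norm \<xi>)\<^sup>2"
  define T where "T = Z / (real DIM('a) - 2) * (t / 2) powr (- ((real DIM('a) - 2) / 2))"
  have Z: "0 < Z" unfolding Z_def by (rule gauss_mass_pos)
  have T: "0 \<le> T" using Z dim by (simp add: T_def)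
  have fin: "sq_norm u\<^sub>0 < \<infinity>" "sq_norm u\<^sub>1 < \<infinity>"
    using u0 u1 by (auto simp: sq_norm_L2_space)
  have [measurable]: "fourier u\<^sub>0 \<in> borel_measurable borel" "fourier u\<^sub>1 \<in> borel_measurable borel"
    using u0 u1 fin by (auto intro: borel_measurable_fourier_L1)
  have ut: "u t \<in> L2_space"
    using v[of t] t by (simp add: fourier_plancherel_def)
  \<comment> \<open>The frequency 0, where \<open>log_symbol\<close> vanishes and the mode does not
    decay, is discarded as a null set.\<close>
  have bound: "AE \<xi> in lborel. (norm (v t \<xi>))\<^sup>2 \<le> 8 * (?A + ?B) * ?S \<xi>
      + 8 * exp (- (t / 4)) * ((norm (fourier u\<^sub>0 \<xi>))\<^sup>2 + (norm (fourier u\<^sub>1 \<xi>))\<^sup>2)"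
    using modes[unfolded AE_completion_iff] AE_lborel_singleton[of 0]
  proof eventually_elim
    case (elim \<xi>)
    show ?case
      using elim t u0 u1 norm_fourier_le_L1_norm
      by (intro mode_bound[where y = "\<lambda>t. v t \<xi>"]) (auto intro!: power_mono)
  qed
  have "sq_norm (v t) \<le> (\<integral>\<^sup>+\<xi>. ennreal (8 * (?A + ?B)) * ennreal (?S \<xi>)
      + ennreal (8 * exp (- (t / 4))) * (ennreal ((norm (fourier u\<^sub>0 \<xi>))\<^sup>2) + ennreal ((norm (fourier u\<^sub>1 \<xi>))\<^sup>2)) \<partial>lborel)"
    unfolding sq_norm_lborel
  proof (rule nn_integral_mono_AE)
    show "AE \<xi> in lborel. ennreal ((norm (v t \<xi>))\<^sup>2) \<le> ennreal (8 * (?A + ?B)) * ennreal (?S \<xi>)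
      + ennreal (8 * exp (- (t / 4))) * (ennreal ((norm (fourier u\<^sub>0 \<xi>))\<^sup>2) + ennreal ((norm (fourier u\<^sub>1 \<xi>))\<^sup>2))"
      using bound
    proof eventually_elim
      case (elim \<xi>)
      then have "ennreal ((norm (v t \<xi>))\<^sup>2) \<le> ennreal (8 * (?A + ?B) * ?S \<xi>
      + 8 * exp (- (t / 4)) * ((norm (fourier u\<^sub>0 \<xi>))\<^sup>2 + (norm (fourier u\<^sub>1 \<xi>))\<^sup>2))"
        by (rule ennreal_leI)
      also have "\<dots> = ennreal (8 * (?A + ?B) * ?S \<xi>)
        + ennreal (8 * exp (- (t / 4)) * ((norm (fourier u\<^sub>0 \<xi>))\<^sup>2 + (norm (fourier u\<^sub>1 \<xi>))\<^sup>2))"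
        by (intro ennreal_plus) auto
      also have "ennreal (8 * (?A + ?B) * ?S \<xi>) = ennreal (8 * (?A + ?B)) * ennreal (?S \<xi>)"
        by (intro ennreal_mult) auto
      also have "ennreal (8 * exp (- (t / 4)) * ((norm (fourier u\<^sub>0 \<xi>))\<^sup>2 + (norm (fourier u\<^sub>1 \<xi>))\<^sup>2))
          = ennreal (8 * exp (- (t / 4))) * ennreal ((norm (fourier u\<^sub>0 \<xi>))\<^sup>2 + (norm (fourier u\<^sub>1 \<xi>))\<^sup>2)"
        by (intro ennreal_mult) auto
      also have "ennreal ((norm (fourier u\<^sub>0 \<xi>))\<^sup>2 + (norm (fourier u\<^sub>1 \<xi>))\<^sup>2)
          = ennreal ((norm (fourier u\<^sub>0 \<xi>))\<^sup>2) + ennreal ((norm (fourier u\<^sub>1 \<xi>))\<^sup>2)"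
        by (intro ennreal_plus) auto
      finally show ?case .
    qed
  qed
  also have "\<dots> = ennreal (8 * (?A + ?B)) * (\<integral>\<^sup>+\<xi>. ennreal (?S \<xi>) \<partial>lborel)
      + ennreal (8 * exp (- (t / 4))) * (sq_norm (fourier u\<^sub>0) + sq_norm (fourier u\<^sub>1))"
    unfolding sq_norm_lborel
    by (subst nn_integral_add, simp, simp, subst (1 2) nn_integral_cmult, simp, simp, subst nn_integral_add, simp_all)
  also have "\<dots> \<le> ennreal (8 * (?A + ?B)) * ennreal T
      + ennreal (8 * exp (- (t / 4))) * (ennreal (Z\<^sup>2) * sq_norm u\<^sub>0 + ennreal (Z\<^sup>2) * sq_norm u\<^sub>1)"
    using u0 u1 fin dim t unfolding T_def Z_def
    by (intro add_mono mult_left_mono nn_integral_singular_gaussian_le sq_norm_fourier_le_L1) auto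
  also have "ennreal (Z\<^sup>2) * sq_norm u\<^sub>0 + ennreal (Z\<^sup>2) * sq_norm u\<^sub>1
      = ennreal (Z\<^sup>2 * ((L2_norm u\<^sub>0)\<^sup>2 + (L2_norm u\<^sub>1)\<^sup>2))"
    using u0 u1 by (simp add: sq_norm_L2_space ennreal_mult'[symmetric] ennreal_plus[symmetric] distrib_left del: ennreal_plus)
  finally have vt: "sq_norm (v t) \<le> ennreal (8 * ((?A + ?B) * T + exp (- (t / 4)) * (Z\<^sup>2 * ((L2_norm u\<^sub>0)\<^sup>2 + (L2_norm u\<^sub>1)\<^sup>2))))"
    using T by (simp add: ennreal_mult'[symmetric] ennreal_plus[symmetric] distrib_left distrib_right mult.assoc del: ennreal_plus)
  have "ennreal ((L2_norm (u t))\<^sup>2) \<le> 8 * sq_norm (v t)"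
    using sq_norm_le_fourier_plancherel[OF v[of t]] t ut by (simp add: sq_norm_L2_space)
  also have "\<dots> \<le> 8 * ennreal (8 * ((?A + ?B) * T + exp (- (t / 4)) * (Z\<^sup>2 * ((L2_norm u\<^sub>0)\<^sup>2 + (L2_norm u\<^sub>1)\<^sup>2))))"
    by (intro mult_left_mono vt) simp
  also have "\<dots> = ennreal (64 * ((?A + ?B) * T + exp (- (t / 4)) * (Z\<^sup>2 * ((L2_norm u\<^sub>0)\<^sup>2 + (L2_norm u\<^sub>1)\<^sup>2))))"
    using ennreal_mult'[of 8 "8 * ((?A + ?B) * T + exp (- (t / 4)) * (Z\<^sup>2 * ((L2_norm u\<^sub>0)\<^sup>2 + (L2_norm u\<^sub>1)\<^sup>2)))"]
    by simp
  finally show ?thesis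
    unfolding T_def[symmetric] using T by (subst (asm) ennreal_le_iff) auto
qed

lemma eventually_exp_le_powr: "eventually (\<lambda>t::real. exp (- (t / 4)) \<le> t powr (- p)) at_top"
proof -
  have "((\<lambda>t::real. t powr p * exp (- (t / 4))) \<longlongrightarrow> 0) at_top"
    by real_asymp
  then have "eventually (\<lambda>t::real. t powr p * exp (- (t / 4)) < 1) at_top"
    by (rule order_tendstoD(2)) simp
  then show ?thesis
    using eventually_gt_at_top[of 0] by eventually_elim (simp add: powr_minus field_simps)
qed

lemma L1_norm_nonneg: "0 \<le> L1_norm f"
  by (simp add: L1_norm_def)

lemma L2_norm_nonneg: "0 \<le> L2_norm f"
  by (simp add: L2_norm_def)

theorem proposition1p2:
  assumes "CARD('n::finite) > 2"
  shows "\<exists>C>0. \<forall>(u\<^sub>0 :: real^'n \<Rightarrow> complex) u\<^sub>1 u.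
    u\<^sub>0 \<in> L2_space \<inter> L1_space \<longrightarrow> u\<^sub>1 \<in> L2_space \<inter> L1_space \<longrightarrow>
    log_damped_wave_solution u\<^sub>0 u\<^sub>1 u \<longrightarrow>
    (\<forall>\<^sub>F t in at_top.
       L2_norm (u t) \<le> C * (L2_norm u\<^sub>0 + L2_norm u\<^sub>1 + L1_norm u\<^sub>0 + L1_norm u\<^sub>1)
         * t powr (- ((real CARD('n) - 2) / 4)))"
proof -
  define n where "n = real CARD('n)"
  define p where "p = (n - 2) / 2"
  define Z where "Z = gauss_mass TYPE(real^'n)"
  \<comment> \<open>The first summand comes from low frequencies, with \<open>2 powr p\<close> from
    \<open>(t / 2) powr (- p)\<close>, the second from high ones. \<open>K\<close> bounds the
    squared norm, hence the witness \<open>sqrt K\<close> and the exponent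
    \<open>p / 2 = (n - 2) / 4\<close>.\<close>
  define K where "K = 64 * (Z / (n - 2) * 2 powr p + Z\<^sup>2)"
  have n: "2 < n" using assms by (simp add: n_def)
  have Z: "0 < Z" unfolding Z_def by (rule gauss_mass_pos)
  have K: "0 < K" using n Z by (simp add: K_def add_pos_pos)
  show ?thesis
  proof (intro exI[of _ "sqrt K"] conjI allI impI)
    show "0 < sqrt K" using K by simp
    fix u\<^sub>0 u\<^sub>1 :: "real^'n \<Rightarrow> complex" and u
    assume u0: "u\<^sub>0 \<in> L2_space \<inter> L1_space" and u1: "u\<^sub>1 \<in> L2_space \<inter> L1_space"
      and sol: "log_damped_wave_solution u\<^sub>0 u\<^sub>1 u"
    define N where "N = L2_norm u\<^sub>0 + L2_norm u\<^sub>1 + L1_norm u\<^sub>0 + L1_norm u\<^sub>1"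
    have nonneg: "0 \<le> L2_norm u\<^sub>0" "0 \<le> L2_norm u\<^sub>1" "0 \<le> L1_norm u\<^sub>0" "0 \<le> L1_norm u\<^sub>1"
      by (auto simp: L1_norm_nonneg L2_norm_nonneg)
    have N: "0 \<le> N" unfolding N_def using nonneg by simp
    have N1: "(L1_norm u\<^sub>0)\<^sup>2 + (L1_norm u\<^sub>1)\<^sup>2 \<le> N\<^sup>2"
      and N2: "(L2_norm u\<^sub>0)\<^sup>2 + (L2_norm u\<^sub>1)\<^sup>2 \<le> N\<^sup>2"
    proof -
      have sq: "x\<^sup>2 + y\<^sup>2 \<le> (x + y)\<^sup>2" if "0 \<le> x" "0 \<le> y" for x y :: real
        using that by (simp add: power2_sum)
      have "(L1_norm u\<^sub>0 + L1_norm u\<^sub>1)\<^sup>2 \<le> N\<^sup>2" "(L2_norm u\<^sub>0 + L2_norm u\<^sub>1)\<^sup>2 \<le> N\<^sup>2"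
        unfolding N_def using nonneg by (auto intro!: power_mono)
      with sq nonneg show "(L1_norm u\<^sub>0)\<^sup>2 + (L1_norm u\<^sub>1)\<^sup>2 \<le> N\<^sup>2" "(L2_norm u\<^sub>0)\<^sup>2 + (L2_norm u\<^sub>1)\<^sup>2 \<le> N\<^sup>2"
        by (meson order_trans)+
    qed
    show "\<forall>\<^sub>F t in at_top. L2_norm (u t) \<le> sqrt K * (L2_norm u\<^sub>0 + L2_norm u\<^sub>1 + L1_norm u\<^sub>0 + L1_norm u\<^sub>1)
         * t powr (- ((real CARD('n) - 2) / 4))"
      \<comment> \<open>The time from which the estimate holds comes only from these two conditions,
        so it depends on the dimension and not on the data.\<close>
      using eventually_exp_le_powr[of p] eventually_gt_at_top[of 0]
    proof eventually_elim
      case (elim t)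
      have "(L2_norm (u t))\<^sup>2 \<le> 64 * (((L1_norm u\<^sub>0)\<^sup>2 + (L1_norm u\<^sub>1)\<^sup>2) * (Z / (n - 2) * (t / 2) powr (- p))
          + exp (- (t / 4)) * (Z\<^sup>2 * ((L2_norm u\<^sub>0)\<^sup>2 + (L2_norm u\<^sub>1)\<^sup>2)))"
        using log_damped_wave_L2_bound[OF _ u0 u1 sol, of t] elim assms
        by (simp add: Z_def n_def p_def)
      also have "\<dots> \<le> 64 * (N\<^sup>2 * (Z / (n - 2) * (t / 2) powr (- p)) + t powr (- p) * (Z\<^sup>2 * N\<^sup>2))"
        using N1 N2 n Z elim by (intro mult_left_mono add_mono mult_right_mono mult_mono) auto
      also have "(t / 2) powr (- p) = 2 powr p * t powr (- p)"
        using elim by (simp add: powr_divide powr_minus field_simps)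
      also have "64 * (N\<^sup>2 * (Z / (n - 2) * (2 powr p * t powr (- p))) + t powr (- p) * (Z\<^sup>2 * N\<^sup>2))
          = K * N\<^sup>2 * t powr (- p)"
        by (simp add: K_def algebra_simps)
      also have "t powr (- p) = (t powr (- (p / 2)))\<^sup>2"
        by (simp add: power2_eq_square powr_add[symmetric])
      also have "K * N\<^sup>2 * (t powr (- (p / 2)))\<^sup>2 = (sqrt K * N * t powr (- (p / 2)))\<^sup>2"
        using K by (simp add: power_mult_distrib)
      finally have "L2_norm (u t) \<le> sqrt K * N * t powr (- (p / 2))"
        by (rule power2_le_imp_le) (use K N in auto)
      then show ?case
        by (simp add: N_def p_def n_def)
    qed
  qed
qed

end
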